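(* Consider the opportunistic beamforming network described in the context with path loss model $G(d)=d^{-\alpha}$, where $\alpha>2$. For a given communication rate $x>0$, the beam outage probability $F_{\mathrm{ub},r}(x)$ is equal to $F^\star_{\mathrm{ub},\gamma}(e^x-1)$, where, for $x>0$, $$F^\star_{\mathrm{ub},\gamma}(x)=\exp\left(\frac{-2\lambda\pi}{\alpha(x+1)^{M-1}}\left(\frac{\rho}{x}\right)^{\frac{2}{\alpha}}\gamma\left(\frac{2}{\alpha},\frac{xD^\alpha}{\rho}\right)\right),$$ and $\gamma(s,z)=\int_0^z t^{s-1}e^{-t}\,dt$ is the lower incomplete gamma function.
   Context: Network model. The cell is the disk of radius $D>0$ in the plane with the base station (BS) at its center. Mobile users (MUs) are distributed over the plane according to a homogeneous Poisson point process of intensity $\lambda>0$. Let $N$ be the (random) number of MUs in the cell, so $N$ is Poisson with mean $\lambda\pi D^2$; given $N$, the MU locations in the cell are i.i.d. uniform on the disk. The BS has $M\ge 1$ antennas, each MU has a single antenna, and the BS uses $M$ orthonormal beamforming vectors $\boldsymbol b_1,\dots,\boldsymbol b_M\in\mathbb C^M$ (generated independently of everything else), with transmit power $\rho>0$ per beam. The fading vector $\boldsymbol h_i\in\mathbb C^M$ of MU $i$ has i.i.d. entries drawn from the zero-mean unit-variance circularly-symmetric complex Gaussian distribution $\mathcal{CN}(0,1)$; fading vectors are independent across MUs and independent of the MU locations. The path loss coefficient of MU $i$ is $g_i=G(d_i)$, where $d_i$ is its distance from the BS. SINR. The signal-to-interference-plus-noise ratio of beam $m$ at MU $i$ is $$\gamma_{m,i}=\frac{|\boldsymbol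 h_i^\top\boldsymbol b_m|^2}{(\rho g_i)^{-1}+\sum_{k\ne m}|\boldsymbol h_i^\top\boldsymbol b_k|^2}.$$ Rate and outage. The BS schedules on each beam the MU in the cell with the highest SINR on that beam; the rate on beam $m$ is $r_m=\log\left(1+\max_i\gamma_{m,i}\right)$, the maximum being over the $N$ MUs in the cell and taken to be $0$ if $N=0$. $F^\star_{\mathrm{ub},\gamma}$ denotes the cumulative distribution function of $\max_i\gamma_{m,i}$ (it does not depend on $m$) for this path loss model. The beam outage probability at target rate $x$ is $F_{\mathrm{ub},r}(x)=\Pr\{r_m\le x\}$. *)

theory Defs
  imports "HOL-Probability.Probability"
begin

text \<open>A homogeneous Poisson point process of intensity \<open>lam\<close> is given by a measurable enumeration
  \<open>X 0, X 1, \<dots>\<close> of its points (almost surely there are infinitely many), so that the number of points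
  in \<open>A\<close> is \<open>card {i. X i \<omega> \<in> A}\<close>. The Poisson law is spelled out because \<open>poisson_pmf\<close> requires
  a positive rate, whereas \<open>A\<close> may be a null set.\<close>

definition homogeneous_ppp ::
    "'a measure \<Rightarrow> real \<Rightarrow> (nat \<Rightarrow> 'a \<Rightarrow> 'b::euclidean_space) \<Rightarrow> bool" where
  "homogeneous_ppp P lam X \<longleftrightarrow>
     (\<forall>i. X i \<in> borel_measurable P) \<and>
     (\<forall>\<omega>\<in>space P. \<forall>A. bounded A \<longrightarrow> finite {i. X i \<omega> \<in> A}) \<and>
     (\<forall>A\<in>sets borel. bounded A \<longrightarrow>
        (\<forall>k. measure P {\<omega> \<in> space P. card {i. X i \<omega> \<in> A} = k} =
             (lam * measure lborel A) ^ k / fact k * exp (- (lam * measure lborel A)))) \<and>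
     (\<forall>(n::nat) A. disjoint_family_on A {..<n} \<longrightarrow>
        (\<forall>j<n. A j \<in> sets borel \<and> bounded (A j)) \<longrightarrow>
        prob_space.indep_vars P (\<lambda>_. count_space UNIV)
          (\<lambda>j \<omega>. card {i. X i \<omega> \<in> A j}) {..<n})"

text \<open>\<open>CN(0,1)\<close>: real and imaginary part are independent centred Gaussians of variance \<open>1/2\<close>.\<close>

definition std_complex_gaussian :: "complex measure" where
  "std_complex_gaussian =
     distr (density lborel (normal_density 0 (sqrt (1/2))) \<Otimes>\<^sub>M
            density lborel (normal_density 0 (sqrt (1/2))))
       borel (\<lambda>(x, y). Complex x y)"

text \<open>Orthonormality refers to the Hermitian inner product; the one of class \<open>real_inner\<close> is only
  its real part.\<close>

definition orthonormal_beams :: "('m \<Rightarrow> complex ^ 'm) \<Rightarrow> bool" where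
  "orthonormal_beams b \<longleftrightarrow>
     (\<forall>k l. (\<Sum>j\<in>UNIV. b k $ j * cnj (b l $ j)) = (if k = l then 1 else 0))"

text \<open>The received amplitude \<open>h\<^sup>T b\<close>, without conjugation.\<close>

definition beam_gain :: "complex ^ 'm \<Rightarrow> complex ^ 'm \<Rightarrow> real" where
  "beam_gain h b = (cmod (\<Sum>j\<in>UNIV. h $ j * b $ j))\<^sup>2"

definition sinr ::
    "real \<Rightarrow> real \<Rightarrow> complex ^ 'm \<Rightarrow> ('m \<Rightarrow> complex ^ 'm) \<Rightarrow> 'm \<Rightarrow> real" where
  "sinr rho g h b m =
     beam_gain h (b m) / (inverse (rho * g) + (\<Sum>k\<in>UNIV - {m}. beam_gain h (b k)))"

definition cell_users :: "real \<Rightarrow> (nat \<Rightarrow> 'a \<Rightarrow> real ^ 2) \<Rightarrow> 'a \<Rightarrow> nat set" where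
  "cell_users D X \<omega> = {i. X i \<omega> \<in> cball 0 D}"

definition max_sinr ::
    "(real \<Rightarrow> real) \<Rightarrow> real \<Rightarrow> real \<Rightarrow> (nat \<Rightarrow> 'a \<Rightarrow> real ^ 2) \<Rightarrow> (nat \<Rightarrow> 'a \<Rightarrow> complex ^ 'm) \<Rightarrow>
     ('m \<Rightarrow> 'a \<Rightarrow> complex ^ 'm) \<Rightarrow> 'm \<Rightarrow> 'a \<Rightarrow> real" where
  "max_sinr G rho D X H B m \<omega> =
     (if cell_users D X \<omega> = {} then 0
      else Max ((\<lambda>i. sinr rho (G (norm (X i \<omega>))) (H i \<omega>) (\<lambda>k. B k \<omega>) m) ` cell_users D X \<omega>))"

definition beam_rate ::
    "(real \<Rightarrow> real) \<Rightarrow> real \<Rightarrow> real \<Rightarrow> (nat \<Rightarrow> 'a \<Rightarrow> real ^ 2) \<Rightarrow> (nat \<Rightarrow> 'a \<Rightarrow> complex ^ 'm) \<Rightarrow>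
     ('m \<Rightarrow> 'a \<Rightarrow> complex ^ 'm) \<Rightarrow> 'm \<Rightarrow> 'a \<Rightarrow> real" where
  "beam_rate G rho D X H B m \<omega> = ln (1 + max_sinr G rho D X H B m \<omega>)"

definition max_sinr_cdf ::
    "'a measure \<Rightarrow> (real \<Rightarrow> real) \<Rightarrow> real \<Rightarrow> real \<Rightarrow> (nat \<Rightarrow> 'a \<Rightarrow> real ^ 2) \<Rightarrow>
     (nat \<Rightarrow> 'a \<Rightarrow> complex ^ 'm) \<Rightarrow> ('m \<Rightarrow> 'a \<Rightarrow> complex ^ 'm) \<Rightarrow> 'm \<Rightarrow> real \<Rightarrow> real" where
  "max_sinr_cdf P G rho D X H B m = cdf (distr P borel (max_sinr G rho D X H B m))"

definition beam_outage ::
    "'a measure \<Rightarrow> (real \<Rightarrow> real) \<Rightarrow> real \<Rightarrow> real \<Rightarrow> (nat \<Rightarrow> 'a \<Rightarrow> real ^ 2) \<Rightarrow>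
     (nat \<Rightarrow> 'a \<Rightarrow> complex ^ 'm) \<Rightarrow> ('m \<Rightarrow> 'a \<Rightarrow> complex ^ 'm) \<Rightarrow> 'm \<Rightarrow> real \<Rightarrow> real" where
  "beam_outage P G rho D X H B m x = measure P {\<omega> \<in> space P. beam_rate G rho D X H B m \<omega> \<le> x}"

text \<open>\<open>X i\<close> and \<open>H i\<close> are the location and fading vector of user \<open>i\<close> (the user's distance from the base
  station at the origin is \<open>norm (X i \<omega>)\<close>), \<open>B\<close> is the (possibly random) beam family; the number of
  antennas is \<open>CARD('m)\<close>. Independence between the differently typed families \<open>X\<close>, \<open>H\<close>, \<open>B\<close> is stated
  for the sigma-algebras they generate, as \<open>indep_var\<close> needs equal value types.\<close>

locale obf_network = prob_space P
  for P :: "'a measure" +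
  fixes lam rho D :: real
    and X :: "nat \<Rightarrow> 'a \<Rightarrow> real ^ 2"
    and H :: "nat \<Rightarrow> 'a \<Rightarrow> complex ^ 'm"
    and B :: "'m \<Rightarrow> 'a \<Rightarrow> complex ^ 'm"
  assumes lam_pos: "lam > 0" and rho_pos: "rho > 0" and D_pos: "D > 0"
    and locations: "homogeneous_ppp P lam X"
    and fading_indep: "indep_vars (\<lambda>_. borel) (\<lambda>(i, j) \<omega>. H i \<omega> $ j) UNIV"
    and fading_distr: "\<And>i j. distr P borel (\<lambda>\<omega>. H i \<omega> $ j) = std_complex_gaussian"
    and beams_measurable: "\<And>m. B m \<in> borel_measurable P"
    and beams_orthonormal: "\<And>\<omega>. \<omega> \<in> space P \<Longrightarrow> orthonormal_beams (\<lambda>m. B m \<omega>)"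
    and locations_indep_fading:
      "indep_set
         (sets (vimage_algebra (space P) (\<lambda>\<omega> i. X i \<omega>) (Pi\<^sub>M UNIV (\<lambda>_. borel))))
         (sets (vimage_algebra (space P) (\<lambda>\<omega> i. H i \<omega>) (Pi\<^sub>M UNIV (\<lambda>_. borel))))"
    and beams_indep:
      "indep_set
         (sets (vimage_algebra (space P) (\<lambda>\<omega> m. B m \<omega>) (Pi\<^sub>M UNIV (\<lambda>_. borel))))
         (sets (vimage_algebra (space P) (\<lambda>\<omega>. (\<lambda>i. X i \<omega>, \<lambda>i. H i \<omega>))
            (Pi\<^sub>M UNIV (\<lambda>_. borel) \<Otimes>\<^sub>M Pi\<^sub>M UNIV (\<lambda>_. borel))))"

definition lower_incomplete_gamma :: "real \<Rightarrow> real \<Rightarrow> real" where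
  "lower_incomplete_gamma s z = (LBINT t:{0..z}. t powr (s - 1) * exp (- t))"

end

theory Submission imports Defs begin

text \<open>Given the locations and the (unitary) beams, the beam gains of a user at distance \<open>r\<close> are i.i.d.
  exponential by rotation invariance of the complex Gaussian vector, so its SINR exceeds \<open>y\<close> with
  probability \<open>p(r\<^sup>2) = exp (- y r\<^sup>\<alpha> / \<rho>) / (1 + y)\<^sup>M\<^sup>-\<^sup>1\<close>, independently over the users. Hence the
  distribution function is the expectation of the product of \<open>1 - p\<close> over the points of the Poisson
  process in the disk, which is \<open>exp (- \<lambda> \<pi> \<integral> p(s) ds)\<close> over \<open>0 \<le> s \<le> D\<^sup>2\<close>. As \<open>p\<close> is radial and decreasing,
  the latter follows by squeezing between step functions on annuli, without the general theory of
  the generating functional. The substitution \<open>t = y s\<^sup>\<alpha>\<^sup>/\<^sup>2 / \<rho>\<close> produces the incomplete gamma function.\<close>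

section \<open>Complex Gaussian vectors\<close>

lemma borel_measurable_vec_lambda [measurable]:
  fixes f :: "'b \<Rightarrow> 'n::finite \<Rightarrow> 'a::euclidean_space"
  assumes "\<And>i. (\<lambda>x. f x i) \<in> borel_measurable M"
  shows "(\<lambda>x. \<chi> i. f x i) \<in> borel_measurable M"
  using assms by (subst borel_measurable_euclidean_space) (auto simp: Basis_vec_def inner_axis)

lemma borel_measurable_vec_nth [measurable]:
  "(\<lambda>x :: 'a::euclidean_space ^ 'n::finite. x $ i) \<in> borel_measurable borel"
  by (intro borel_measurable_continuous_onI continuous_intros)

text \<open>Lebesgue measure is determined by its values on boxes. A box of vectors is the product
  of the boxes of its components, and its volume factors because the basis vectors
  \<open>axis i b\<close> are indexed by pairs. This links fading entries, given one by one, to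
  rotations of the whole vector.\<close>

lemma lborel_vec:
  "distr (Pi\<^sub>M UNIV (\<lambda>_. lborel)) borel (\<lambda>f. \<chi> i. f i) = (lborel :: ('a::euclidean_space ^ 'n) measure)"
proof (rule lborel_eqI[symmetric])
  interpret product_sigma_finite "\<lambda>_::'n. lborel :: 'a measure" ..
  have meas [measurable]: "(\<lambda>f. \<chi> i. f i) \<in> Pi\<^sub>M UNIV (\<lambda>_::'n. lborel :: 'a measure) \<rightarrow>\<^sub>M borel"
    by (rule borel_measurable_vec_lambda) simp
  fix l u :: "'a ^ 'n"
  assume le: "\<And>b. b \<in> Basis \<Longrightarrow> l \<bullet> b \<le> u \<bullet> b"
  have le': "l $ i \<bullet> b \<le> u $ i \<bullet> b" if "b \<in> Basis" for i b
    using le[of "axis i b"] that by (simp add: axis_in_Basis_iff inner_axis)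
  have eq: "(\<lambda>f. \<chi> i. f i) -` box l u \<inter> space (Pi\<^sub>M UNIV (\<lambda>_. lborel)) = Pi\<^sub>E UNIV (\<lambda>i. box (l $ i) (u $ i))"
    by (auto simp: box_def Basis_vec_def inner_axis space_PiM PiE_iff)
  have inj: "inj_on (\<lambda>(i, b). axis i b) (UNIV \<times> (Basis::'a set))"
    by (auto simp: inj_on_def axis_eq_axis)
  have Bas: "(Basis :: ('a ^ 'n) set) = (\<lambda>(i, b). axis i b) ` (UNIV \<times> Basis)"
    by (auto simp: Basis_vec_def)
  have "emeasure (distr (Pi\<^sub>M UNIV (\<lambda>_. lborel)) borel (\<lambda>f. \<chi> i. f i)) (box l u) =
      (\<Prod>i\<in>UNIV. ennreal (\<Prod>b\<in>Basis. (u $ i - l $ i) \<bullet> b))"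
    by (subst emeasure_distr)
      (auto simp: eq emeasure_PiM emeasure_lborel_box le' intro!: prod.cong)
  also have "\<dots> = ennreal (\<Prod>i\<in>UNIV. \<Prod>b\<in>Basis. (u $ i - l $ i) \<bullet> b)"
    by (rule prod_ennreal) (auto intro!: prod_nonneg simp: le' inner_diff_left)
  also have "(\<Prod>i\<in>UNIV. \<Prod>b\<in>Basis. (u $ i - l $ i) \<bullet> b) = (\<Prod>b\<in>Basis. (u - l) \<bullet> b)"
    unfolding Bas by (subst prod.reindex[OF inj]) (simp add: prod.cartesian_product inner_axis split_def)
  finally show "emeasure (distr (Pi\<^sub>M UNIV (\<lambda>_. lborel)) borel (\<lambda>f. \<chi> i. f i)) (box l u) =
      ennreal (\<Prod>b\<in>Basis. (u - l) \<bullet> b)" .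
qed simp

text \<open>Boxes suffice again: with respect to the basis of \<open>1\<close> and the imaginary
  unit, a box of complex numbers is a box of pairs.\<close>

lemma lborel_complex: "distr lborel borel (\<lambda>(x, y). Complex x y) = lborel"
proof (rule lborel_eqI[symmetric])
  have meas [measurable]: "(\<lambda>(x, y). Complex x y) \<in> borel \<rightarrow>\<^sub>M borel"
    unfolding split_def Complex_eq
    by (intro borel_measurable_continuous_onI continuous_intros)
  fix l u :: complex
  assume le: "\<And>b. b \<in> Basis \<Longrightarrow> l \<bullet> b \<le> u \<bullet> b"
  have "(\<lambda>(x, y). Complex x y) -` box l u = box (Re l, Im l) (Re u, Im u)"
    by (auto simp: box_def Basis_complex_def Basis_prod_def)
  then show "emeasure (distr lborel borel (\<lambda>(x, y). Complex x y)) (box l u) =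
      ennreal (\<Prod>b\<in>Basis. (u - l) \<bullet> b)"
    using le[of 1] le[of \<i>]
    by (subst emeasure_distr)
      (auto simp: emeasure_lborel_box_eq Basis_prod_def Basis_complex_def prod.union_disjoint
        prod.insert_if)
qed simp

text \<open>With variance \<open>1/2\<close> each real density is
  \<open>exp (- x^2) / sqrt pi\<close>, so the product depends on the modulus alone; rotation
  invariance rests on this form.\<close>

lemma std_complex_gaussian_density:
  "std_complex_gaussian = density lborel (\<lambda>z. ennreal (exp (- (cmod z)\<^sup>2) / pi))"
proof -
  let ?n = "normal_density 0 (sqrt (1/2))"
  have meas [measurable]: "(\<lambda>(x, y). Complex x y) \<in> borel \<rightarrow>\<^sub>M borel"
    unfolding split_def Complex_eq
    by (intro borel_measurable_continuous_onI continuous_intros)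
  have "density lborel (\<lambda>x. ennreal (?n x)) \<Otimes>\<^sub>M density lborel (\<lambda>x. ennreal (?n x)) =
      density lborel (\<lambda>(x, y). ennreal (?n x) * ennreal (?n y))"
    using prob_space_normal_density[of "sqrt (1/2)" 0]
    by (subst pair_measure_density)
      (auto simp: lborel_prod intro!: prob_space_imp_sigma_finite sigma_finite_lborel)
  moreover have "ennreal (?n x) * ennreal (?n y) = ennreal (exp (- (cmod (Complex x y))\<^sup>2) / pi)" for x y
  proof -
    have "sqrt pi * sqrt pi = pi" by simp
    moreover have "(cmod (Complex x y))\<^sup>2 = x * x + y * y"
      unfolding cmod_power2 by (simp add: power2_eq_square)
    ultimately show ?thesis
    by (simp add: normal_density_def ennreal_mult[symmetric] mult_exp_exp power2_eq_square
        field_simps)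
  qed
  ultimately have "std_complex_gaussian =
      distr (density lborel (\<lambda>p. (\<lambda>z. ennreal (exp (- (cmod z)\<^sup>2) / pi)) ((\<lambda>(x, y). Complex x y) p)))
       borel (\<lambda>(x, y). Complex x y)"
    by (simp add: std_complex_gaussian_def split_def)
  also have "\<dots> = density (distr lborel borel (\<lambda>(x, y). Complex x y)) (\<lambda>z. ennreal (exp (- (cmod z)\<^sup>2) / pi))"
    by (rule density_distr[symmetric]) simp_all
  finally show ?thesis by (simp add: lborel_complex)
qed

text \<open>As in the uniqueness proof for Haar measure: with \<open>\<mu>\<close> the image measure and \<open>U\<close> the unit ball,
  the double integral of \<open>1\<^sub>A(x) 1\<^sub>U(x + y)\<close> gives \<open>\<mu>(A) |U| = |A| \<mu>(U)\<close>, and \<open>\<mu>(U) = |U|\<close>.\<close>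

lemma distr_lborel_isometry:
  fixes T :: "'a::euclidean_space \<Rightarrow> 'a"
  assumes lin: "linear T" and iso: "\<And>x. norm (T x) = norm x"
  shows "distr lborel borel T = lborel"
proof (rule measure_eqI)
  have T [measurable]: "T \<in> borel \<rightarrow>\<^sub>M borel"
    using lin by (intro borel_measurable_continuous_onI linear_continuous_on linear_conv_bounded_linear[THEN iffD1])
  have "inj T"
    using linear_inj_iff_eq_0[OF lin] iso by (metis norm_eq_zero)
  \<comment> \<open>An injective linear map of a finite-dimensional space into itself is onto, so
    every translation is by some \<open>T d\<close>, as \<open>shift_T\<close> needs.\<close>
  then have surj: "surj T" by (rule linear_inj_imp_surj[OF lin])
  have shift: "(\<integral>\<^sup>+x. f (x + c) \<partial>lborel) = (\<integral>\<^sup>+x. f x \<partial>lborel)"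
    if [measurable]: "f \<in> borel_measurable borel" for c and f :: "'a \<Rightarrow> ennreal"
    by (subst (2) lborel_distr_plus[of c, symmetric]) (simp add: nn_integral_distr add.commute)
  have shift_T: "(\<integral>\<^sup>+x. f (T x + c) \<partial>lborel) = (\<integral>\<^sup>+x. f (T x) \<partial>lborel)"
    if [measurable]: "f \<in> borel_measurable borel" for c and f :: "'a \<Rightarrow> ennreal"
  proof -
    obtain d where d: "c = T d" using surj by auto
    show ?thesis
      unfolding d linear_add[OF lin, symmetric] by (rule shift[of "\<lambda>x. f (T x)"]) simp
  qed
  have neg: "(\<integral>\<^sup>+x. f (- x) \<partial>lborel) = (\<integral>\<^sup>+x. f x \<partial>lborel)"
    if [measurable]: "f \<in> borel_measurable borel" for f :: "'a \<Rightarrow> ennreal"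
    by (subst (2) lborel_affine[of "-1" 0])
      (simp_all add: nn_integral_density nn_integral_distr)
  let ?B = "ball 0 1 :: 'a set"
  have B [measurable]: "?B \<in> sets borel" by simp
  fix A assume "A \<in> sets (distr lborel borel T)"
  then have A [measurable]: "A \<in> sets borel" by simp
  have TA: "T -` A \<in> sets borel" using measurable_sets[OF T A] by simp
  have shift_A: "(\<integral>\<^sup>+y. indicator A (T x + y) \<partial>lborel) * indicator ?B (T x) =
      (\<integral>\<^sup>+y. indicator A y \<partial>lborel) * (indicator ?B x :: ennreal)" for x
  proof -
    have "indicator ?B (T x) = (indicator ?B x :: ennreal)"
      by (simp add: indicator_def iso)
    then show ?thesis
      using shift[OF borel_measurable_indicator[OF A], of "T x"] by (simp only: add.commute)
  qed
  have "emeasure lborel (T -` A) * emeasure lborel ?B =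
      (\<integral>\<^sup>+x. indicator A (T x) * (\<integral>\<^sup>+y. indicator ?B y \<partial>lborel) \<partial>lborel)"
    by (simp add: nn_integral_multc TA flip: indicator_vimage)
  also have "\<dots> = (\<integral>\<^sup>+x. indicator A (T x) * (\<integral>\<^sup>+y. indicator ?B (y + T x) \<partial>lborel) \<partial>lborel)"
    by (subst shift[OF borel_measurable_indicator]) simp_all
  also have "\<dots> = (\<integral>\<^sup>+x. (\<integral>\<^sup>+y. indicator A (T x) * indicator ?B (y + T x) \<partial>lborel) \<partial>lborel)"
    by (intro nn_integral_cong nn_integral_cmult[symmetric]) measurable
  also have "\<dots> = (\<integral>\<^sup>+y. (\<integral>\<^sup>+x. indicator A (T x) * indicator ?B (y + T x) \<partial>lborel) \<partial>lborel)"
    by (rule lborel_pair.Fubini') measurable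
  \<comment> \<open>By \<open>shift_T\<close> the translation by \<open>y\<close> moves from the
    ball to \<open>A\<close>.\<close>
  also have "\<dots> = (\<integral>\<^sup>+y. (\<integral>\<^sup>+x. indicator A (T x - y) * indicator ?B (T x) \<partial>lborel) \<partial>lborel)"
  proof (rule nn_integral_cong)
    show "(\<integral>\<^sup>+x. indicator A (T x) * indicator ?B (y + T x) \<partial>lborel) =
        (\<integral>\<^sup>+x. indicator A (T x - y) * indicator ?B (T x) \<partial>lborel)" for y
      using shift_T[of "\<lambda>z. indicator A (z - y) * indicator ?B z" y] by (simp add: add.commute)
  qed
  also have "\<dots> = (\<integral>\<^sup>+x. (\<integral>\<^sup>+y. indicator A (T x - y) * indicator ?B (T x) \<partial>lborel) \<partial>lborel)"
    by (rule lborel_pair.Fubini') measurable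
  \<comment> \<open>Reflecting \<open>y\<close> turns the inner integral into one over a translate
    of \<open>A\<close>, whose value does not depend on \<open>x\<close> by
    \<open>shift_A\<close>.\<close>
  also have "\<dots> = (\<integral>\<^sup>+x. (\<integral>\<^sup>+y. indicator A (T x + y) \<partial>lborel) * indicator ?B (T x) \<partial>lborel)"
    by (subst neg[symmetric]) (simp_all add: nn_integral_multc)
  also have "\<dots> = (\<integral>\<^sup>+x. (\<integral>\<^sup>+y. indicator A y \<partial>lborel) * indicator ?B x \<partial>lborel)"
    by (simp only: shift_A)
  also have "\<dots> = emeasure lborel A * emeasure lborel ?B"
    by (simp add: nn_integral_cmult)
  finally have eq: "emeasure lborel (T -` A) * emeasure lborel ?B = emeasure lborel A * emeasure lborel ?B" .
  have "emeasure lborel ?B \<noteq> 0" "emeasure lborel ?B \<noteq> top"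
    using content_ball_pos[of 1 "0::'a"] emeasure_lborel_ball_finite[of "0::'a" 1]
    by (auto simp: measure_def)
  with eq have "emeasure lborel (T -` A) = emeasure lborel A"
    by (metis ennreal_mult_divide_eq)
  then show "emeasure (distr lborel borel T) A = emeasure lborel A"
    by (simp add: emeasure_distr)
qed simp

section \<open>Annuli and Gaussian tails\<close>

lemma emeasure_annulus:
  assumes "DIM('a::euclidean_space) = 2" "0 \<le> s" "s \<le> t"
  shows "emeasure lborel {z::'a. s < (norm z)\<^sup>2 \<and> (norm z)\<^sup>2 \<le> t} = ennreal (pi * (t - s))"
proof -
  have "norm z \<le> sqrt u \<longleftrightarrow> (norm z)\<^sup>2 \<le> u" if "0 \<le> u" for u and z :: 'a
    using that by (metis abs_norm_cancel real_sqrt_abs real_sqrt_le_iff)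
  then have "{z::'a. s < (norm z)\<^sup>2 \<and> (norm z)\<^sup>2 \<le> t} = cball 0 (sqrt t) - cball 0 (sqrt s)"
    using assms(2,3) by (auto simp: not_le)
  also have "emeasure lborel \<dots> = ennreal (pi * t) - ennreal (pi * s)"
    using assms by (subst emeasure_Diff) (auto simp: emeasure_cball unit_ball_vol_2 intro: order_trans[OF _ real_sqrt_le_mono])
  \<comment> \<open>The area is linear in the squared radii, which is why squared radii serve as the
    radial variable later on.\<close>
  also have "\<dots> = ennreal (pi * (t - s))"
    using assms by (simp add: ennreal_minus right_diff_distrib)
  finally show ?thesis .
qed

text \<open>Two instances are needed: \<open>c = 1\<close> gives the tail of \<open>|z|^2\<close>,
  and \<open>t = 0\<close> with \<open>c = 1 + y\<close> gives its Laplace transform.\<close>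

lemma nn_integral_gaussian_tail:
  assumes c: "c > 0" and t: "0 \<le> t"
  shows "(\<integral>\<^sup>+z. ennreal (exp (- c * (cmod z)\<^sup>2)) * indicator {z. t < (cmod z)\<^sup>2} z \<partial>lborel) =
    ennreal (pi * exp (- c * t) / c)"
proof -
  \<comment> \<open>Layer cake: the level sets of the density are annuli.\<close>
  have layer: "ennreal (exp (- c * a)) = (\<integral>\<^sup>+s. ennreal (c * exp (- c * s)) * indicator {a..} s \<partial>lborel)" for a
  proof -
    have "(\<integral>\<^sup>+s. ennreal (c * exp (- c * s)) * indicator {a..} s \<partial>lborel) = 0 - (- exp (- c * a))"
    proof (rule nn_integral_FTC_atLeast)
      show "((\<lambda>s. - exp (- c * s)) \<longlongrightarrow> 0) at_top"
        using c by real_asymp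
    qed (use c in \<open>auto intro!: derivative_eq_intros\<close>)
    then show ?thesis by simp
  qed
  have area: "(\<integral>\<^sup>+z. indicator {z. t < (cmod z)\<^sup>2} z * indicator {(cmod z)\<^sup>2..} s \<partial>lborel) =
      ennreal (pi * (s - t)) * indicator {t..} s" for s
  proof -
    have "(\<integral>\<^sup>+z. indicator {z. t < (cmod z)\<^sup>2} z * indicator {(cmod z)\<^sup>2..} s \<partial>lborel) =
        (\<integral>\<^sup>+z. indicator {z. t < (cmod z)\<^sup>2 \<and> (cmod z)\<^sup>2 \<le> s} z \<partial>lborel)"
      by (intro nn_integral_cong) (simp add: indicator_def)
    also have "\<dots> = emeasure lborel {z. t < (cmod z)\<^sup>2 \<and> (cmod z)\<^sup>2 \<le> s}"
      by (rule nn_integral_indicator) measurable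
    also have "\<dots> = ennreal (pi * (s - t)) * indicator {t..} s"
    proof (cases "t \<le> s")
      case True
      then show ?thesis using emeasure_annulus[where 'a=complex, of t s] t by simp
    next
      case False
      then have *: "{z. t < (cmod z)\<^sup>2 \<and> (cmod z)\<^sup>2 \<le> s} = {}" by auto
      show ?thesis unfolding * using False by simp
    qed
    finally show ?thesis .
  qed
  have "(\<integral>\<^sup>+z. ennreal (exp (- c * (cmod z)\<^sup>2)) * indicator {z. t < (cmod z)\<^sup>2} z \<partial>lborel) =
      (\<integral>\<^sup>+z. (\<integral>\<^sup>+s. ennreal (c * exp (- c * s)) * (indicator {z. t < (cmod z)\<^sup>2} z * indicator {(cmod z)\<^sup>2..} s) \<partial>lborel) \<partial>lborel)"
    unfolding layer
    by (subst nn_integral_multc[symmetric]) (auto intro!: nn_integral_cong simp: mult_ac)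
  also have "\<dots> = (\<integral>\<^sup>+s. (\<integral>\<^sup>+z. ennreal (c * exp (- c * s)) * (indicator {z. t < (cmod z)\<^sup>2} z * indicator {(cmod z)\<^sup>2..} s) \<partial>lborel) \<partial>lborel)"
    unfolding indicator_def atLeast_iff mem_Collect_eq
    by (rule lborel_pair.Fubini') measurable
  also have "\<dots> = (\<integral>\<^sup>+s. ennreal (c * exp (- c * s)) * (ennreal (pi * (s - t)) * indicator {t..} s) \<partial>lborel)"
    unfolding area[symmetric]
    by (intro nn_integral_cong nn_integral_cmult) (unfold indicator_def atLeast_iff mem_Collect_eq, measurable)
  also have "\<dots> = (\<integral>\<^sup>+s. ennreal (c * exp (- c * s) * (pi * (s - t))) * indicator {t..} s \<partial>lborel)"
    using c by (intro nn_integral_cong) (auto simp: indicator_def ennreal_mult')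
  \<comment> \<open>The antiderivative comes from integration by parts. It vanishes at infinity, and
    at \<open>s = t\<close> only the summand \<open>1 / c\<close> survives.\<close>
  also have "\<dots> = ennreal (0 - (- (pi * (t - t + 1 / c) * exp (- c * t))))"
  proof (rule nn_integral_FTC_atLeast[where F = "\<lambda>s. - (pi * (s - t + 1 / c) * exp (- c * s))"])
    show "((\<lambda>s. - (pi * (s - t + 1 / c) * exp (- c * s))) \<longlongrightarrow> 0) at_top"
      using c by real_asymp
    show "((\<lambda>s. - (pi * (s - t + 1 / c) * exp (- c * s))) has_real_derivative c * exp (- c * s) * (pi * (s - t))) (at s)" if "t \<le> s" for s
      using c by (auto intro!: derivative_eq_intros simp: field_simps)
  qed (use c in auto)
  finally show ?thesis by simp
qed

lemma sets_std_complex_gaussian [measurable_cong, simp]: "sets std_complex_gaussian = sets borel"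
  by (simp add: std_complex_gaussian_def)

lemma space_std_complex_gaussian [simp]: "space std_complex_gaussian = UNIV"
  by (simp add: std_complex_gaussian_def)

text \<open>The factor \<open>1 / pi\<close> of the density cancels the area constant of the annuli,
  so \<open>|z|^2\<close> is exponential with rate one.\<close>

lemma emeasure_std_complex_gaussian_tail:
  assumes "0 \<le> t"
  shows "emeasure std_complex_gaussian {z. t < (cmod z)\<^sup>2} = ennreal (exp (- t))"
proof -
  have "emeasure std_complex_gaussian {z. t < (cmod z)\<^sup>2} =
      (\<integral>\<^sup>+z. ennreal (1 / pi) * (ennreal (exp (- 1 * (cmod z)\<^sup>2)) * indicator {z. t < (cmod z)\<^sup>2} z) \<partial>lborel)"
    unfolding std_complex_gaussian_density
    by (subst emeasure_density) (auto simp: ennreal_mult'[symmetric] mult.assoc[symmetric] intro!: nn_integral_cong)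
  also have "\<dots> = ennreal (1 / pi) * ennreal (pi * exp (- 1 * t) / 1)"
    using assms by (subst nn_integral_cmult) (simp_all only: nn_integral_gaussian_tail zero_less_one, measurable)
  finally show ?thesis by (simp add: ennreal_mult'[symmetric])
qed

text \<open>The Gaussian factor and the exponential merge into one of rate \<open>1 + y\<close>,
  which yields the Laplace transform of an exponential variable. At \<open>y = 0\<close> this says
  that the total mass is one.\<close>

lemma nn_integral_std_complex_gaussian_exp:
  assumes "0 \<le> y"
  shows "(\<integral>\<^sup>+z. ennreal (exp (- y * (cmod z)\<^sup>2)) \<partial>std_complex_gaussian) = ennreal (1 / (1 + y))"
proof -
  have c: "0 < 1 + y" using assms by simp
  have pointwise: "ennreal (exp (- (cmod z)\<^sup>2) / pi) * ennreal (exp (- y * (cmod z)\<^sup>2)) =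
      ennreal (1 / pi) * (ennreal (exp (- (1 + y) * (cmod z)\<^sup>2)) * indicator {z. 0 < (cmod z)\<^sup>2} z)"
    if "z \<noteq> 0" for z
  proof -
    have "exp (- (cmod z)\<^sup>2) / pi * exp (- y * (cmod z)\<^sup>2) = 1 / pi * exp (- (1 + y) * (cmod z)\<^sup>2)"
      by (simp add: exp_add[symmetric] algebra_simps)
    then show ?thesis using that by (simp add: ennreal_mult'[symmetric])
  qed
  have "(\<integral>\<^sup>+z. ennreal (exp (- y * (cmod z)\<^sup>2)) \<partial>std_complex_gaussian) =
      (\<integral>\<^sup>+z. ennreal (exp (- (cmod z)\<^sup>2) / pi) * ennreal (exp (- y * (cmod z)\<^sup>2)) \<partial>lborel)"
    unfolding std_complex_gaussian_density by (rule nn_integral_density) measurable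
  \<comment> \<open>The tail formula at \<open>t = 0\<close> carries an indicator that drops the
    origin, a null set.\<close>
  also have "\<dots> =
      (\<integral>\<^sup>+z. ennreal (1 / pi) * (ennreal (exp (- (1 + y) * (cmod z)\<^sup>2)) * indicator {z. 0 < (cmod z)\<^sup>2} z) \<partial>lborel)"
    using AE_lborel_singleton[of "0::complex"] by (intro nn_integral_cong_AE) (elim eventually_mono pointwise)
  also have "\<dots> = ennreal (1 / pi) *
      (\<integral>\<^sup>+z. ennreal (exp (- (1 + y) * (cmod z)\<^sup>2)) * indicator {z. 0 < (cmod z)\<^sup>2} z \<partial>lborel)"
    by (rule nn_integral_cmult) measurable
  also have "\<dots> = ennreal (1 / pi) * ennreal (pi * exp (- (1 + y) * 0) / (1 + y))"
    unfolding nn_integral_gaussian_tail[OF c order_refl] ..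
  also have "\<dots> = ennreal (1 / (1 + y))"
    using c by (simp add: ennreal_mult'[symmetric])
  finally show ?thesis .
qed

interpretation std_complex_gaussian: prob_space std_complex_gaussian
  using nn_integral_std_complex_gaussian_exp[of 0] by (intro prob_spaceI) simp

section \<open>Signal against interference for independent Gaussians\<close>

lemma sets_gaussian_interference:
  "{f. y * (c + (\<Sum>k\<in>UNIV - {m}. (cmod (f k))\<^sup>2)) < (cmod (f m))\<^sup>2} \<in>
    sets (Pi\<^sub>M UNIV (\<lambda>_ :: 'm::finite. std_complex_gaussian))"
proof -
  have "{f \<in> space (Pi\<^sub>M UNIV (\<lambda>_ :: 'm. std_complex_gaussian)).
      y * (c + (\<Sum>k\<in>UNIV - {m}. (cmod (f k))\<^sup>2)) < (cmod (f m))\<^sup>2} \<in>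
    sets (Pi\<^sub>M UNIV (\<lambda>_. std_complex_gaussian))"
    by measurable
  then show ?thesis by (simp add: space_PiM)
qed

text \<open>Given the interferers, component \<open>m\<close> exceeds the threshold with an
  exponential probability, which factors over the interferers. Each factor integrates to
  \<open>1 / (1 + y)\<close>, and there are \<open>CARD('m) - 1\<close> of them.\<close>

lemma emeasure_gaussian_interference:
  fixes m :: "'m::finite"
  assumes y: "0 \<le> y" and c: "0 \<le> c"
  shows "emeasure (Pi\<^sub>M UNIV (\<lambda>_. std_complex_gaussian))
      {f. y * (c + (\<Sum>k\<in>UNIV - {m}. (cmod (f k))\<^sup>2)) < (cmod (f m))\<^sup>2} =
    ennreal (exp (- (y * c)) / (1 + y) ^ (CARD('m) - 1))"
proof -
  interpret product_sigma_finite "\<lambda>_::'m. std_complex_gaussian" ..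
  let ?J = "UNIV - {m}"
  let ?E = "\<lambda>f::'m \<Rightarrow> complex. indicator {f. y * (c + (\<Sum>k\<in>?J. (cmod (f k))\<^sup>2)) < (cmod (f m))\<^sup>2} f :: ennreal"
  have ins: "insert m ?J = UNIV" by auto
  have [measurable]: "?E \<in> borel_measurable (Pi\<^sub>M UNIV (\<lambda>_. std_complex_gaussian))"
    unfolding indicator_def mem_Collect_eq by measurable
  have inner: "(\<integral>\<^sup>+z. ?E (f(m := z)) \<partial>std_complex_gaussian) =
      ennreal (exp (- (y * c))) * (\<Prod>k\<in>?J. ennreal (exp (- y * (cmod (f k))\<^sup>2)))" for f
  proof -
    let ?t = "y * (c + (\<Sum>k\<in>?J. (cmod (f k))\<^sup>2))"
    have "(\<integral>\<^sup>+z. ?E (f(m := z)) \<partial>std_complex_gaussian) =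
        (\<integral>\<^sup>+z. indicator {z. ?t < (cmod z)\<^sup>2} z \<partial>std_complex_gaussian)"
      by (intro nn_integral_cong) (auto simp: indicator_def)
    also have "\<dots> = emeasure std_complex_gaussian {z. ?t < (cmod z)\<^sup>2}"
      by (rule nn_integral_indicator) measurable
    also have "\<dots> = ennreal (exp (- ?t))"
      using y c by (intro emeasure_std_complex_gaussian_tail mult_nonneg_nonneg add_nonneg_nonneg sum_nonneg) auto
    also have "exp (- ?t) = exp (- (y * c)) * (\<Prod>k\<in>?J. exp (- y * (cmod (f k))\<^sup>2))"
      by (simp add: exp_sum[symmetric] mult_exp_exp sum_negf sum_distrib_left[symmetric] algebra_simps)
    finally show ?thesis by (simp only: ennreal_mult' prod_ennreal exp_ge_zero)
  qed
  have "emeasure (Pi\<^sub>M UNIV (\<lambda>_. std_complex_gaussian))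
      {f. y * (c + (\<Sum>k\<in>?J. (cmod (f k))\<^sup>2)) < (cmod (f m))\<^sup>2} = integral\<^sup>N (Pi\<^sub>M UNIV (\<lambda>_. std_complex_gaussian)) ?E"
    by (rule nn_integral_indicator[symmetric, OF sets_gaussian_interference])
  \<comment> \<open>Fubini: component \<open>m\<close> is integrated first, with the others
    frozen.\<close>
  also have "\<dots> = (\<integral>\<^sup>+f. (\<integral>\<^sup>+z. ?E (f(m := z)) \<partial>std_complex_gaussian) \<partial>Pi\<^sub>M ?J (\<lambda>_. std_complex_gaussian))"
    using product_nn_integral_insert[of ?J m ?E] by (simp add: ins)
  also have "\<dots> = ennreal (exp (- (y * c))) * (\<Prod>k\<in>?J. ennreal (1 / (1 + y)))"
    unfolding inner
    by (subst nn_integral_cmult, measurable, subst product_nn_integral_prod)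
      (simp_all only: nn_integral_std_complex_gaussian_exp[OF y] finite_Diff finite, measurable)
  also have "\<dots> = ennreal (exp (- (y * c)) / (1 + y) ^ (CARD('m) - 1))"
    using y by (simp add: ennreal_power ennreal_mult'[symmetric] power_divide card_Diff_singleton)
  finally show ?thesis .
qed

section \<open>The complex Gaussian vector and its unitary invariance\<close>

definition gaussian_vec :: "(complex ^ 'm) measure" where
  "gaussian_vec = distr (Pi\<^sub>M UNIV (\<lambda>_. std_complex_gaussian)) borel (\<lambda>f. \<chi> i. f i)"

text \<open>The product of the coordinate densities depends only on the norm, since squared moduli
  add up. The product measures are compared on rectangles, where integrals factor, and then carried
  over to vectors.\<close>

lemma gaussian_vec_density:
  "(gaussian_vec :: (complex ^ 'm) measure) =
    density lborel (\<lambda>h. ennreal (exp (- (norm h)\<^sup>2) / pi ^ CARD('m)))"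
proof -
  let ?g = "\<lambda>z. ennreal (exp (- (cmod z)\<^sup>2) / pi)"
  interpret L: product_sigma_finite "\<lambda>_::'m. lborel :: complex measure" ..
  interpret S: product_sigma_finite "\<lambda>_::'m. std_complex_gaussian" ..
  have "density (Pi\<^sub>M UNIV (\<lambda>_::'m. lborel)) (\<lambda>f. \<Prod>i\<in>UNIV. ?g (f i)) = Pi\<^sub>M UNIV (\<lambda>_. std_complex_gaussian)"
  proof (rule S.PiM_eqI)
    fix A :: "'m \<Rightarrow> complex set"
    assume A: "\<And>i. i \<in> UNIV \<Longrightarrow> A i \<in> sets std_complex_gaussian"
    then have [measurable]: "A i \<in> sets borel" for i by simp
    have "emeasure (density (Pi\<^sub>M UNIV (\<lambda>_. lborel)) (\<lambda>f. \<Prod>i\<in>UNIV. ?g (f i))) (Pi\<^sub>E UNIV A) =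
       (\<integral>\<^sup>+f. (\<Prod>i\<in>UNIV. ?g (f i)) * indicator (Pi\<^sub>E UNIV A) f \<partial>Pi\<^sub>M UNIV (\<lambda>_. lborel))"
      by (rule emeasure_density) (auto intro!: sets_PiM_I_finite)
    also have "\<dots> = (\<integral>\<^sup>+f. (\<Prod>i\<in>UNIV. ?g (f i) * indicator (A i) (f i)) \<partial>Pi\<^sub>M UNIV (\<lambda>_. lborel))"
      by (intro nn_integral_cong) (auto simp: prod.distrib indicator_def PiE_iff)
    also have "\<dots> = (\<Prod>i\<in>UNIV. \<integral>\<^sup>+z. ?g z * indicator (A i) z \<partial>lborel)"
      by (rule L.product_nn_integral_prod) auto
    also have "\<dots> = (\<Prod>i\<in>UNIV. emeasure std_complex_gaussian (A i))"
      unfolding std_complex_gaussian_density by (simp add: emeasure_density)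
    finally show "emeasure (density (Pi\<^sub>M UNIV (\<lambda>_. lborel)) (\<lambda>f. \<Prod>i\<in>UNIV. ?g (f i))) (Pi\<^sub>E UNIV A) =
      (\<Prod>i\<in>UNIV. emeasure std_complex_gaussian (A i))" .
  qed (auto intro!: sets_PiM_cong)
  moreover have "(\<Prod>i\<in>UNIV. ?g (f i)) = ennreal (exp (- (norm (\<chi> i. f i))\<^sup>2) / pi ^ CARD('m))" for f :: "'m \<Rightarrow> complex"
    by (subst prod_ennreal)
      (auto simp: prod_dividef exp_sum[symmetric] sum_negf norm_vec_def L2_set_def sum_nonneg)
  ultimately have "(gaussian_vec :: (complex ^ 'm) measure) =
      distr (density (Pi\<^sub>M UNIV (\<lambda>_::'m. lborel)) (\<lambda>f. (\<lambda>h. ennreal (exp (- (norm h)\<^sup>2) / pi ^ CARD('m))) (\<chi> i. f i))) borel (\<lambda>f. \<chi> i. f i)"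
    by (simp add: gaussian_vec_def)
  also have "\<dots> = density (distr (Pi\<^sub>M UNIV (\<lambda>_::'m. lborel)) borel (\<lambda>f. \<chi> i. f i)) (\<lambda>h. ennreal (exp (- (norm h)\<^sup>2) / pi ^ CARD('m)))"
    by (rule density_distr[symmetric]) measurable
  finally show ?thesis by (simp add: lborel_vec)
qed

text \<open>The map \<open>T\<close> preserves both ingredients: the density is a function of the
  norm, and Lebesgue measure is invariant.\<close>

lemma gaussian_vec_isometry:
  fixes T :: "complex ^ 'm \<Rightarrow> complex ^ 'm"
  assumes "linear T" "\<And>x. norm (T x) = norm x"
  shows "distr gaussian_vec borel T = gaussian_vec"
proof -
  have [measurable]: "T \<in> borel \<rightarrow>\<^sub>M borel"
    using assms(1) by (intro borel_measurable_continuous_onI linear_continuous_on linear_conv_bounded_linear[THEN iffD1])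
  have "distr (density lborel (\<lambda>h. (\<lambda>h. ennreal (exp (- (norm h)\<^sup>2) / pi ^ CARD('m))) (T h))) borel T =
    density (distr lborel borel T) (\<lambda>h. ennreal (exp (- (norm h)\<^sup>2) / pi ^ CARD('m)))"
    by (rule density_distr[symmetric]) measurable
  then show ?thesis
    by (simp add: gaussian_vec_density assms distr_lborel_isometry)
qed

text \<open>Parseval's identity for the square matrix with rows \<open>b k\<close>.\<close>

lemma sum_beam_gain:
  fixes h :: "complex ^ 'm"
  assumes "orthonormal_beams b"
  shows "(\<Sum>k\<in>UNIV. beam_gain h (b k)) = (norm h)\<^sup>2"
proof -
  let ?A = "\<chi> k j. b k $ j" and ?A' = "\<chi> j k. cnj (b k $ j)"
  have "?A ** ?A' = mat 1"
    using assms by (simp add: orthonormal_beams_def matrix_matrix_mult_def mat_def vec_eq_iff)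
  \<comment> \<open>A right inverse of a square matrix is also a left inverse: orthonormal rows give
    orthonormal columns, and the sum over \<open>k\<close> pairs columns.\<close>
  then have "?A' ** ?A = mat 1" by (simp add: matrix_left_right_inverse)
  then have cols: "(\<Sum>k\<in>UNIV. cnj (b k $ l) * b k $ j) = (if l = j then 1 else 0)" for j l
    by (simp add: matrix_matrix_mult_def mat_def vec_eq_iff)
  have "complex_of_real (\<Sum>k\<in>UNIV. beam_gain h (b k)) =
      (\<Sum>k\<in>UNIV. \<Sum>j\<in>UNIV. \<Sum>l\<in>UNIV. h $ j * cnj (h $ l) * (cnj (b k $ l) * b k $ j))"
    unfolding beam_gain_def of_real_sum complex_norm_square cnj_sum sum_product
    by (simp add: mult_ac)
  also have "\<dots> = (\<Sum>j\<in>UNIV. \<Sum>l\<in>UNIV. \<Sum>k\<in>UNIV. h $ j * cnj (h $ l) * (cnj (b k $ l) * b k $ j))"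
    by (subst sum.swap) (intro sum.cong refl sum.swap)
  also have "\<dots> = (\<Sum>j\<in>UNIV. h $ j * cnj (h $ j))"
    by (simp add: sum_distrib_left[symmetric] cols if_distrib[of "\<lambda>x. _ * x"] cong: if_cong)
  also have "\<dots> = complex_of_real ((norm h)\<^sup>2)"
    by (simp add: norm_vec_def L2_set_def sum_nonneg complex_norm_square[symmetric])
  finally show ?thesis by (simp only: of_real_eq_iff)
qed

lemma borel_measurable_beam_gain [measurable (raw)]:
  assumes [measurable]: "f \<in> borel_measurable M" "g \<in> borel_measurable M"
  shows "(\<lambda>x. beam_gain (f x) (g x)) \<in> borel_measurable M"
  unfolding beam_gain_def by measurable

text \<open>The vector of received amplitudes is a linear isometric image of \<open>h\<close>, hence
  again Gaussian with independent entries. The event then compares one entry with the others, with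
  noise \<open>inverse (rho * g)\<close>, and is the complement of the strict event computed
  before.\<close>

lemma emeasure_sinr_le:
  fixes b :: "'m \<Rightarrow> complex ^ 'm"
  assumes b: "orthonormal_beams b" and y: "0 \<le> y" and g: "0 < rho * g"
  shows "emeasure gaussian_vec {h. sinr rho g h b m \<le> y} =
    ennreal (1 - exp (- (y * inverse (rho * g))) / (1 + y) ^ (CARD('m) - 1))"
proof -
  interpret PiM: prob_space "Pi\<^sub>M UNIV (\<lambda>_::'m. std_complex_gaussian)"
    by (intro prob_space_PiM std_complex_gaussian.prob_space_axioms)
  let ?c = "inverse (rho * g)"
  let ?T = "\<lambda>h. \<chi> k. \<Sum>j\<in>UNIV. h $ j * b k $ j"
  let ?S = "{h::complex ^ 'm. (cmod (h $ m))\<^sup>2 \<le> y * (?c + (\<Sum>k\<in>UNIV - {m}. (cmod (h $ k))\<^sup>2))}"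
  let ?F = "{f::'m \<Rightarrow> complex. y * (?c + (\<Sum>k\<in>UNIV - {m}. (cmod (f k))\<^sup>2)) < (cmod (f m))\<^sup>2}"
  have lin: "linear ?T"
    by (rule linearI) (simp_all add: vec_eq_iff distrib_right sum.distrib scaleR_sum_right)
  have "(norm (?T h))\<^sup>2 = (norm h)\<^sup>2" for h
    unfolding sum_beam_gain[OF b, of h, symmetric] by (simp add: norm_vec_def L2_set_def sum_nonneg beam_gain_def)
  then have iso: "norm (?T h) = norm h" for h by simp
  have "{h. sinr rho g h b m \<le> y} = ?T -` ?S"
  proof -
    \<comment> \<open>The noise term makes the denominator positive, so the fraction can be
      cleared.\<close>
    have "0 < ?c + (\<Sum>k\<in>UNIV - {m}. beam_gain h (b k))" for h
      using positive_imp_inverse_positive[OF g] by (intro add_pos_nonneg sum_nonneg) (simp_all only: beam_gain_def zero_le_power2)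
    then show ?thesis
      by (auto simp: sinr_def beam_gain_def pos_divide_le_eq)
  qed
  also have "emeasure gaussian_vec \<dots> = emeasure (distr gaussian_vec borel ?T) ?S"
    by (subst emeasure_distr) (simp_all add: gaussian_vec_def, measurable)
  also have "\<dots> = emeasure (Pi\<^sub>M UNIV (\<lambda>_. std_complex_gaussian)) (space (Pi\<^sub>M UNIV (\<lambda>_. std_complex_gaussian)) - ?F)"
    unfolding gaussian_vec_isometry[OF lin iso]
    by (subst gaussian_vec_def, subst emeasure_distr) (auto simp: space_PiM not_less intro!: arg_cong2[where f=emeasure])
  also have "\<dots> = 1 - emeasure (Pi\<^sub>M UNIV (\<lambda>_. std_complex_gaussian)) ?F"
    by (subst emeasure_compl[OF sets_gaussian_interference]) (simp_all add: PiM.emeasure_space_1)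
  finally show ?thesis
    using y g by (subst (asm) emeasure_gaussian_interference[OF y less_imp_le[OF positive_imp_inverse_positive[OF g]]]) (auto simp: ennreal_minus ennreal_1[symmetric] simp del: ennreal_1)
qed

section \<open>Integrals of decreasing functions\<close>

text \<open>Induction over cells of width \<open>d\<close>: on the new cell a decreasing function
  lies between its right and left endpoint values.\<close>

lemma integral_antimono_bounds:
  fixes q :: "real \<Rightarrow> real" and d :: real and k :: nat
  assumes anti: "antimono_on {0..} q" and cont: "continuous_on {0..} q" and d: "0 \<le> d"
  shows "(\<Sum>j<k. d * q (d * Suc j)) \<le> integral {0..d * real k} q"
    and "integral {0..d * real k} q \<le> (\<Sum>j<k. d * q (d * real j))"
proof (induction k)
  case (Suc k)
  have int: "q integrable_on {a..b}" if "0 \<le> a" for a b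
    using that by (intro integrable_continuous_interval continuous_on_subset[OF cont]) auto
  have mono: "q b \<le> q a" if "0 \<le> a" "a \<le> b" for a b
    using monotone_onD[OF anti, of a b] that by simp
  let ?I = "{d * real k..d * real (Suc k)}"
  have le: "0 \<le> d * real k" "d * real k \<le> d * real (Suc k)"
    using d by (auto intro: mult_left_mono)
  have len: "d * real (Suc k) - d * real k = d"
    by (simp add: algebra_simps)
  have split: "integral {0..d * real (Suc k)} q = integral {0..d * real k} q + integral ?I q"
    using Henstock_Kurzweil_Integration.integral_combine[OF le int] by simp
  have "integral ?I (\<lambda>_. q (d * real (Suc k))) \<le> integral ?I q"
    using le by (intro integral_le int mono) auto
  then have lower: "d * q (d * Suc k) \<le> integral ?I q"
    using le len by simp
  have "integral ?I q \<le> integral ?I (\<lambda>_. q (d * real k))"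
    using le by (intro integral_le int mono) auto
  then have upper: "integral ?I q \<le> d * q (d * k)"
    using le len by simp
  {
    case 1
    show ?case using Suc.IH(1) lower split by simp
  next
    case 2
    show ?case using Suc.IH(2) upper split by simp
  }
qed simp_all

text \<open>The two step sums differ by a telescoping sum, namely
  \<open>T * (q 0 - q T) / n\<close>, so any number between them for all \<open>n\<close> is pinched
  to the integral.\<close>

lemma eq_integral_if_between_step_sums:
  fixes q :: "real \<Rightarrow> real"
  assumes anti: "antimono_on {0..} q" and cont: "continuous_on {0..} q" and T: "0 \<le> T"
    and lower: "\<And>n::nat. 0 < n \<Longrightarrow> (\<Sum>j<n. T / n * q (T / n * Suc j)) \<le> c"
    and upper: "\<And>n::nat. 0 < n \<Longrightarrow> c \<le> (\<Sum>j<n. T / n * q (T / n * real j))"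
  shows "c = integral {0..T} q"
proof -
  let ?K = "T * (q 0 - q T)"
  have bound: "\<bar>c - integral {0..T} q\<bar> \<le> ?K / Suc n" for n
  proof -
    define d where "d = T / real (Suc n)"
    have dT: "d * real (Suc n) = T" by (simp add: d_def)
    have "(\<Sum>j<Suc n. d * q (d * real j)) - (\<Sum>j<Suc n. d * q (d * Suc j)) =
        d * (\<Sum>j<Suc n. q (d * real j) - q (d * Suc j))"
      by (simp only: sum_subtractf right_diff_distrib sum_distrib_left)
    also have "\<dots> = ?K / Suc n"
      using sum_lessThan_telescope'[of "\<lambda>j. q (d * real j)" "Suc n"]
      by (simp only: dT) (simp add: d_def)
    finally have gap: "(\<Sum>j<Suc n. d * q (d * real j)) - (\<Sum>j<Suc n. d * q (d * Suc j)) = ?K / Suc n" .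
    have d: "0 \<le> d" using T by (simp add: d_def)
    show ?thesis
      using lower[of "Suc n", folded d_def] upper[of "Suc n", folded d_def] gap
        integral_antimono_bounds[OF anti cont d, of "Suc n"]
      unfolding abs_le_iff dT by linarith
  qed
  have "(\<lambda>n. ?K / Suc n) \<longlonglongrightarrow> 0"
    by real_asymp
  then have "\<bar>c - integral {0..T} q\<bar> \<le> 0"
    by (rule LIMSEQ_le_const) (use bound in blast)
  then show ?thesis by simp
qed

text \<open>Here \<open>?g\<close> inverts the substitution
  \<open>t = a * s powr (\<alpha> / 2)\<close>, and its exponent
  \<open>\<beta> = 2 / \<alpha>\<close> becomes the shape parameter of the incomplete gamma
  function.\<close>

lemma integral_exp_powr:
  assumes \<alpha>: "0 < \<alpha>" and a: "0 < a" and D: "0 < D"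
  shows "integral {0..D\<^sup>2} (\<lambda>s. exp (- (a * s powr (\<alpha> / 2)))) =
    2 / \<alpha> * (1 / a) powr (2 / \<alpha>) * lower_incomplete_gamma (2 / \<alpha>) (a * D powr \<alpha>)"
proof -
  define \<beta> where "\<beta> = 2 / \<alpha>"
  have \<beta>: "0 < \<beta>" using \<alpha> by (simp add: \<beta>_def)
  let ?z = "a * D powr \<alpha>"
  let ?f = "\<lambda>s. exp (- (a * s powr (\<alpha> / 2)))"
  let ?g = "\<lambda>t. (t / a) powr \<beta>"
  let ?g' = "\<lambda>t. \<beta> * (1 / a) powr \<beta> * t powr (\<beta> - 1)"
  let ?G = "\<lambda>t. t powr (\<beta> - 1) * exp (- t)"
  have z: "0 \<le> ?z" using a by simp
  have gz: "?g ?z = D\<^sup>2"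
    using a D \<alpha> by (simp add: \<beta>_def powr_powr)
  have fg: "?f (?g t) = exp (- t)" if "0 \<le> t" for t
    using that a \<alpha> by (simp add: \<beta>_def powr_powr)
  have "((\<lambda>t. ?g' t *\<^sub>R ?f (?g t)) has_integral (integral {?g 0..?g ?z} ?f - integral {?g ?z..?g 0} ?f)) {0..?z}"
  \<comment> \<open>The point \<open>0\<close> is excepted because \<open>?g\<close> has infinite
    slope there when \<open>\<beta> < 1\<close>.\<close>
  proof (rule has_integral_substitution_general[where s = "{0}"])
    show "?g ` {0..?z} \<subseteq> {0..D\<^sup>2}"
      using a \<beta> unfolding gz[symmetric] by (auto intro!: powr_mono2 simp: pos_divide_le_eq mult.commute)
    show "continuous_on {0..D\<^sup>2} ?f"
      using \<alpha> by (intro continuous_intros continuous_on_powr') auto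
    show "continuous_on {0..?z} ?g"
      using \<beta> a by (intro continuous_on_powr' continuous_intros) auto
    show "(?g has_field_derivative ?g' t) (at t within {0..?z})" if "t \<in> {0..?z} - {0}" for t
      using that a \<beta>
      by (auto intro!: derivative_eq_intros simp: powr_divide powr_diff field_simps)
  qed (use z in auto)
  moreover have "integral {?g ?z..?g 0} ?f = 0"
    unfolding gz using D by simp
  ultimately have "((\<lambda>t. ?g' t *\<^sub>R ?f (?g t)) has_integral integral {0..D\<^sup>2} ?f) {0..?z}"
    unfolding gz using \<beta> by simp
  then have "((\<lambda>t. (\<beta> * (1 / a) powr \<beta>) * ?G t) has_integral integral {0..D\<^sup>2} ?f) {0..?z}"
    by (rule has_integral_eq[rotated]) (simp add: fg)
  moreover have c: "\<beta> * (1 / a) powr \<beta> \<noteq> 0" using a \<beta> by simp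
  ultimately have G: "(?G has_integral integral {0..D\<^sup>2} ?f / (\<beta> * (1 / a) powr \<beta>)) {0..?z}"
    by (subst (asm) has_integral_mult_right_iff) (auto simp: field_simps)
  \<comment> \<open>The integrand may be unbounded at \<open>0\<close>; as it is nonnegative, its
    gauge integral still yields the Lebesgue integrability that
    \<open>lower_incomplete_gamma\<close> calls for.\<close>
  then have "set_integrable lebesgue {0..?z} ?G"
    by (intro nonnegative_absolutely_integrable_1) (auto simp: has_integral_integrable)
  then have "set_integrable lborel {0..?z} ?G"
    unfolding set_integrable_def by (subst (asm) integrable_completion) auto
  then have "(LBINT t:{0..?z}. ?G t) = integral {0..?z} ?G"
    by (rule set_borel_integral_eq_integral)
  then have "lower_incomplete_gamma \<beta> ?z = integral {0..D\<^sup>2} ?f / (\<beta> * (1 / a) powr \<beta>)"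
    using G by (simp add: lower_incomplete_gamma_def integral_unique)
  then show ?thesis
    using c by (simp add: \<beta>_def field_simps)
qed

section \<open>Poisson point processes\<close>

context
  fixes P :: "'a measure" and lam :: real and X :: "nat \<Rightarrow> 'a \<Rightarrow> 'b::euclidean_space"
  assumes prob: "prob_space P" and ppp: "homogeneous_ppp P lam X" and lam: "0 < lam"
begin

interpretation prob_space P by (rule prob)

lemma ppp_count_indep:
  fixes n :: nat
  assumes "disjoint_family_on A {..<n}" "\<And>j. j < n \<Longrightarrow> A j \<in> sets borel" "\<And>j. j < n \<Longrightarrow> bounded (A j)"
  shows "indep_vars (\<lambda>_. count_space UNIV) (\<lambda>j \<omega>. card {i. X i \<omega> \<in> A j}) {..<n}"
  by (rule ppp[unfolded homogeneous_ppp_def, THEN conjunct2, THEN conjunct2, THEN conjunct2, rule_format])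
    (use assms in auto)

text \<open>Measurability of a count is part of \<open>indep_vars\<close>, read off from a family
  with a single member.\<close>

lemma ppp_count_measurable:
  assumes "A \<in> sets borel" "bounded A"
  shows "(\<lambda>\<omega>. card {i. X i \<omega> \<in> A}) \<in> P \<rightarrow>\<^sub>M count_space UNIV"
proof -
  have "indep_vars (\<lambda>_. count_space UNIV) (\<lambda>j \<omega>. card {i. X i \<omega> \<in> A}) {..<1::nat}"
    using assms by (intro ppp_count_indep) (auto simp: disjoint_family_on_def)
  then show ?thesis
    unfolding indep_vars_def by (auto dest!: conjunct1 bspec[of _ _ 0])
qed

lemma ppp_prob_count:
  assumes "A \<in> sets borel" "bounded A"
  shows "prob {\<omega> \<in> space P. card {i. X i \<omega> \<in> A} = k} =
    (lam * measure lborel A) ^ k / fact k * exp (- (lam * measure lborel A))"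
  by (rule ppp[unfolded homogeneous_ppp_def, THEN conjunct2, THEN conjunct2, THEN conjunct1, rule_format])
    (use assms in auto)

text \<open>This is the generating function of the Poisson law: splitting by the value of the count
  leaves the exponential series in \<open>u * ?a\<close>.\<close>

lemma ppp_nn_integral_power_count:
  assumes A: "A \<in> sets borel" "bounded A" and u: "0 \<le> u"
  shows "(\<integral>\<^sup>+\<omega>. ennreal (u ^ card {i. X i \<omega> \<in> A}) \<partial>P) = ennreal (exp (- (lam * measure lborel A * (1 - u))))"
proof -
  let ?N = "\<lambda>\<omega>. card {i. X i \<omega> \<in> A}" and ?a = "lam * measure lborel A"
  have N [measurable]: "?N \<in> P \<rightarrow>\<^sub>M count_space UNIV"
    by (rule ppp_count_measurable[OF A])
  have a: "0 \<le> ?a" using lam by simp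
  have "(\<integral>\<^sup>+\<omega>. ennreal (u ^ ?N \<omega>) \<partial>P) =
      (\<integral>\<^sup>+\<omega>. (\<Sum>k. ennreal (u ^ k) * indicator {\<omega> \<in> space P. ?N \<omega> = k} \<omega>) \<partial>P)"
  proof (rule nn_integral_cong)
    fix \<omega> assume "\<omega> \<in> space P"
    then have "(\<Sum>k. ennreal (u ^ k) * indicator {\<omega> \<in> space P. ?N \<omega> = k} \<omega>) =
        (\<Sum>k\<in>{?N \<omega>}. ennreal (u ^ k) * indicator {\<omega> \<in> space P. ?N \<omega> = k} \<omega>)"
      by (intro suminf_finite) auto
    then show "ennreal (u ^ ?N \<omega>) = (\<Sum>k. ennreal (u ^ k) * indicator {\<omega> \<in> space P. ?N \<omega> = k} \<omega>)"
      using \<open>\<omega> \<in> space P\<close> by simp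
  qed
  also have "\<dots> = (\<Sum>k. \<integral>\<^sup>+\<omega>. ennreal (u ^ k) * indicator {\<omega> \<in> space P. ?N \<omega> = k} \<omega> \<partial>P)"
    by (rule nn_integral_suminf) measurable
  also have "\<dots> = (\<Sum>k. ennreal ((u * ?a) ^ k / fact k * exp (- ?a)))"
  proof (rule suminf_cong)
    fix k
    have "{\<omega> \<in> space P. ?N \<omega> = k} \<in> events" by measurable
    then have "(\<integral>\<^sup>+\<omega>. ennreal (u ^ k) * indicator {\<omega> \<in> space P. ?N \<omega> = k} \<omega> \<partial>P) =
        ennreal (u ^ k) * ennreal (prob {\<omega> \<in> space P. ?N \<omega> = k})"
      by (simp add: nn_integral_cmult_indicator emeasure_eq_measure)
    also have "\<dots> = ennreal ((u * ?a) ^ k / fact k * exp (- ?a))"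
      unfolding ppp_prob_count[OF A]
      using a u by (subst ennreal_mult'[symmetric]) (auto simp: power_mult_distrib mult_ac)
    finally show "(\<integral>\<^sup>+\<omega>. ennreal (u ^ k) * indicator {\<omega> \<in> space P. ?N \<omega> = k} \<omega> \<partial>P) =
      ennreal ((u * ?a) ^ k / fact k * exp (- ?a))" .
  qed
  also have "\<dots> = ennreal (exp (u * ?a) * exp (- ?a))"
  proof (rule suminf_ennreal_eq)
    show "(\<lambda>k. (u * ?a) ^ k / fact k * exp (- ?a)) sums (exp (u * ?a) * exp (- ?a))"
      using exp_converges[of "u * ?a"] by (intro sums_mult2) (simp add: divide_inverse_commute)
  qed (use u a in auto)
  also have "exp (u * ?a) * exp (- ?a) = exp (- (?a * (1 - u)))"
    by (simp add: exp_add[symmetric] algebra_simps)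
  finally show ?thesis .
qed

text \<open>Counts in disjoint regions are independent, so their generating functions multiply and
  the exponents add.\<close>

lemma ppp_nn_integral_prod_power_count:
  fixes n :: nat
  assumes A: "disjoint_family_on A {..<n}" "\<And>j. j < n \<Longrightarrow> A j \<in> sets borel" "\<And>j. j < n \<Longrightarrow> bounded (A j)"
    and u: "\<And>j. j < n \<Longrightarrow> 0 \<le> u j"
  shows "(\<integral>\<^sup>+\<omega>. (\<Prod>j<n. ennreal (u j ^ card {i. X i \<omega> \<in> A j})) \<partial>P) =
    ennreal (exp (- (lam * (\<Sum>j<n. measure lborel (A j) * (1 - u j)))))"
proof -
  have "indep_vars (\<lambda>_. borel) (\<lambda>j \<omega>. ennreal (u j ^ card {i. X i \<omega> \<in> A j})) {..<n}"
    by (rule indep_vars_compose2[OF ppp_count_indep[OF A]]) auto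
  then have "(\<integral>\<^sup>+\<omega>. (\<Prod>j<n. ennreal (u j ^ card {i. X i \<omega> \<in> A j})) \<partial>P) =
      (\<Prod>j<n. \<integral>\<^sup>+\<omega>. ennreal (u j ^ card {i. X i \<omega> \<in> A j}) \<partial>P)"
    by (intro indep_vars_nn_integral) auto
  also have "\<dots> = (\<Prod>j<n. ennreal (exp (- (lam * measure lborel (A j) * (1 - u j)))))"
    using A u by (intro prod.cong refl ppp_nn_integral_power_count) auto
  also have "\<dots> = ennreal (exp (- (lam * (\<Sum>j<n. measure lborel (A j) * (1 - u j)))))"
  proof -
    have "- (lam * (\<Sum>j<n. measure lborel (A j) * (1 - u j))) =
        (\<Sum>j<n. - (lam * measure lborel (A j) * (1 - u j)))"
      by (simp only: sum_distrib_left sum_negf mult.assoc)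
    then show ?thesis by (simp only: prod_ennreal exp_ge_zero exp_sum finite_lessThan)
  qed
  finally show ?thesis .
qed

lemma ppp_finite: "bounded A \<Longrightarrow> \<omega> \<in> space P \<Longrightarrow> finite {i. X i \<omega> \<in> A}"
  using ppp unfolding homogeneous_ppp_def by blast

text \<open>A singleton has measure zero, so its count vanishes with probability
  \<open>exp 0 = 1\<close>. This discards the centre, which the annuli miss and where the path loss
  degenerates.\<close>

lemma ppp_AE_nonzero: "AE \<omega> in P. \<forall>i. X i \<omega> \<noteq> 0"
proof -
  have [measurable]: "(\<lambda>\<omega>. card {i. X i \<omega> \<in> {0}}) \<in> P \<rightarrow>\<^sub>M count_space UNIV"
    by (rule ppp_count_measurable) auto
  have "prob {\<omega> \<in> space P. card {i. X i \<omega> \<in> {0}} = 0} = 1"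
    by (subst ppp_prob_count) auto
  moreover have "{\<omega> \<in> space P. card {i. X i \<omega> \<in> {0}} = 0} \<in> events" by measurable
  ultimately have "AE \<omega> in P. \<omega> \<in> {\<omega> \<in> space P. card {i. X i \<omega> \<in> {0}} = 0}"
    by (simp only: prob_eq_1)
  then have "AE \<omega> in P. card {i. X i \<omega> \<in> {0}} = 0"
    by (rule eventually_mono) blast
  \<comment> \<open>Since \<open>card\<close> is \<open>0\<close> on infinite sets too, finiteness
    in bounded sets is what turns the zero count into absence of points.\<close>
  then show ?thesis
    using AE_space by eventually_elim (use ppp_finite[of "{0}"] in auto)
qed

end

section \<open>Radial generating functional of the Poisson process\<close>

lemma prod_mono_ennreal:
  fixes f g :: "'a \<Rightarrow> ennreal"
  shows "(\<And>i. i \<in> A \<Longrightarrow> f i \<le> g i) \<Longrightarrow> prod f A \<le> prod g A"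
  by (induction A rule: infinite_finite_induct) (auto intro: mult_mono)

text \<open>In the squared radius \<open>s\<close> planar area is \<open>pi ds\<close>, whence the
  factor \<open>pi\<close> and the upper limit \<open>D^2\<close>.\<close>

lemma ppp_nn_integral_radial_prod:
  fixes X :: "nat \<Rightarrow> 'a \<Rightarrow> real ^ 2"
  assumes prob: "prob_space P" and ppp: "homogeneous_ppp P lam X" and lam: "0 < lam" and D: "0 \<le> D"
    and anti: "antimono_on {0..} p" and cont: "continuous_on {0..} p"
    and le1: "\<And>s. 0 \<le> s \<Longrightarrow> p s \<le> 1"
  shows "(\<integral>\<^sup>+\<omega>. (\<Prod>i\<in>cell_users D X \<omega>. ennreal (1 - p ((norm (X i \<omega>))\<^sup>2))) \<partial>P) =
    ennreal (exp (- (lam * pi * integral {0..D\<^sup>2} p)))"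
proof -
  interpret prob_space P by (rule prob)
  let ?f = "\<lambda>\<omega>. \<Prod>i\<in>cell_users D X \<omega>. ennreal (1 - p ((norm (X i \<omega>))\<^sup>2))"
  \<comment> \<open>On each of \<open>n\<close> annuli of equal area replace \<open>p\<close> by its value at the inner or outer radius; the
    products then only depend on the independent Poisson counts. The annuli miss the origin, which
    almost surely contains no point.\<close>
  have bounds: "ennreal (exp (- (lam * pi * (\<Sum>j<n. D\<^sup>2 / n * p (D\<^sup>2 / n * real j))))) \<le> integral\<^sup>N P ?f \<and>
      integral\<^sup>N P ?f \<le> ennreal (exp (- (lam * pi * (\<Sum>j<n. D\<^sup>2 / n * p (D\<^sup>2 / n * Suc j)))))"
    if n: "0 < n" for n :: nat
  proof -
    define d where "d = D\<^sup>2 / n"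
    have d: "0 \<le> d" by (simp add: d_def)
    have dn: "d * n = D\<^sup>2" using n by (simp add: d_def)
    define A where "A j = {v :: real ^ 2. d * real j < (norm v)\<^sup>2 \<and> (norm v)\<^sup>2 \<le> d * Suc j}" for j
    have dmono: "d * real i \<le> d * real j" if "i \<le> j" for i j
      using that d by (intro mult_left_mono) auto
    have A: "disjoint_family_on A {..<n}" "\<And>j. A j \<in> sets borel" "\<And>j. bounded (A j)"
    proof -
      have "A i \<inter> A j = {}" if "i < j" for i j
        using dmono[of "Suc i" j] that by (auto simp: A_def)
      then show "disjoint_family_on A {..<n}"
        unfolding disjoint_family_on_def by (metis Int_commute nat_neq_iff)
      show "A j \<in> sets borel" for j unfolding A_def by measurable
      have "norm v \<le> sqrt (d * Suc j)" if "v \<in> A j" for v j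
        using that by (auto simp: A_def intro: real_le_rsqrt)
      then show "bounded (A j)" for j by (auto simp: bounded_iff)
    qed
    have "emeasure lborel (A j) = ennreal (pi * d)" for j
    proof -
      have "emeasure lborel (A j) = ennreal (pi * (d * Suc j - d * j))"
        unfolding A_def by (rule emeasure_annulus) (use d dmono[of j "Suc j"] in \<open>simp_all del: of_nat_Suc\<close>)
      then show ?thesis by (simp add: algebra_simps)
    qed
    then have area: "measure lborel (A j) = pi * d" for j
      using d by (simp add: measure_def)
    have fin: "finite {i. X i \<omega> \<in> A j}" if "\<omega> \<in> space P" for \<omega> j
      using ppp_finite[OF prob ppp lam A(3) that] .
    have split: "?f \<omega> = (\<Prod>j<n. \<Prod>i\<in>{i. X i \<omega> \<in> A j}. ennreal (1 - p ((norm (X i \<omega>))\<^sup>2)))"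
      if "\<omega> \<in> space P" "\<forall>i. X i \<omega> \<noteq> 0" for \<omega>
    proof -
      have "cell_users D X \<omega> = (\<Union>j<n. {i. X i \<omega> \<in> A j})"
      proof (intro equalityI subsetI)
        fix i assume "i \<in> cell_users D X \<omega>"
        then have "(norm (X i \<omega>))\<^sup>2 \<le> d * n"
          unfolding dn using D by (auto simp: cell_users_def intro: power_mono)
        moreover have "0 < (norm (X i \<omega>))\<^sup>2" using that by simp
        \<comment> \<open>The induction finds the innermost annulus whose outer radius reaches the
          point; strict positivity excludes \<open>n = 0\<close>.\<close>
        ultimately have "\<exists>j<n. d * real j < (norm (X i \<omega>))\<^sup>2 \<and> (norm (X i \<omega>))\<^sup>2 \<le> d * Suc j"
        proof (induction n)
          case (Suc n)
          then show ?case
            by (cases "(norm (X i \<omega>))\<^sup>2 \<le> d * n") (auto simp: less_Suc_eq not_le)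
        qed simp
        then show "i \<in> (\<Union>j<n. {i. X i \<omega> \<in> A j})" by (auto simp: A_def)
      next
        fix i assume "i \<in> (\<Union>j<n. {i. X i \<omega> \<in> A j})"
        then obtain j where "j < n" "(norm (X i \<omega>))\<^sup>2 \<le> d * Suc j" by (auto simp: A_def)
        then have "(norm (X i \<omega>))\<^sup>2 \<le> D\<^sup>2"
          using dmono[of "Suc j" n] by (simp only: dn Suc_le_eq) (meson order_trans)
        then show "i \<in> cell_users D X \<omega>"
          using D by (auto simp: cell_users_def intro: power2_le_imp_le)
      qed
      moreover have "\<forall>i\<in>{..<n}. \<forall>j\<in>{..<n}. i \<noteq> j \<longrightarrow> {k. X k \<omega> \<in> A i} \<inter> {k. X k \<omega> \<in> A j} = {}"
        using A(1) by (auto simp: disjoint_family_on_def)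
      ultimately show ?thesis
        using fin[OF that(1)] by (simp add: prod.UNION_disjoint)
    qed
    have pA: "1 - p (d * real j) \<le> 1 - p ((norm v)\<^sup>2)" "1 - p ((norm v)\<^sup>2) \<le> 1 - p (d * Suc j)" if "v \<in> A j" for v j
      using that d monotone_onD[OF anti, of "d * real j" "(norm v)\<^sup>2"] monotone_onD[OF anti, of "(norm v)\<^sup>2" "d * Suc j"]
      by (auto simp: A_def)
    \<comment> \<open>The generating functions require nonnegative bases; this is where
      \<open>p \<le> 1\<close> enters.\<close>
    have nn: "0 \<le> 1 - p (d * real j)" for j using le1[of "d * real j"] d by simp
    have "ennreal (exp (- (lam * (\<Sum>j<n. measure lborel (A j) * (1 - (1 - p (d * real j))))))) =
        (\<integral>\<^sup>+\<omega>. (\<Prod>j<n. ennreal ((1 - p (d * real j)) ^ card {i. X i \<omega> \<in> A j})) \<partial>P)"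
      by (intro ppp_nn_integral_prod_power_count[OF prob ppp lam, symmetric] A nn)
    also have "\<dots> \<le> integral\<^sup>N P ?f"
    proof (rule nn_integral_mono_AE)
      show "AE \<omega> in P. (\<Prod>j<n. ennreal ((1 - p (d * real j)) ^ card {i. X i \<omega> \<in> A j})) \<le> ?f \<omega>"
        using ppp_AE_nonzero[OF prob ppp lam] AE_space
      proof eventually_elim
        fix \<omega> assume \<omega>: "\<forall>i. X i \<omega> \<noteq> 0" "\<omega> \<in> space P"
        show "(\<Prod>j<n. ennreal ((1 - p (d * real j)) ^ card {i. X i \<omega> \<in> A j})) \<le> ?f \<omega>"
          unfolding split[OF \<omega>(2,1)]
        proof (rule prod_mono_ennreal)
          fix j
          have "ennreal ((1 - p (d * real j)) ^ card {i. X i \<omega> \<in> A j}) =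
              (\<Prod>i\<in>{i. X i \<omega> \<in> A j}. ennreal (1 - p (d * real j)))"
            using nn by (simp add: ennreal_power)
          also have "\<dots> \<le> (\<Prod>i\<in>{i. X i \<omega> \<in> A j}. ennreal (1 - p ((norm (X i \<omega>))\<^sup>2)))"
            by (intro prod_mono_ennreal) (auto intro: ennreal_leI pA)
          finally show "ennreal ((1 - p (d * real j)) ^ card {i. X i \<omega> \<in> A j}) \<le>
              (\<Prod>i\<in>{i. X i \<omega> \<in> A j}. ennreal (1 - p ((norm (X i \<omega>))\<^sup>2)))" .
        qed
      qed
    qed
    finally have lower: "ennreal (exp (- (lam * (\<Sum>j<n. measure lborel (A j) * (1 - (1 - p (d * real j))))))) \<le> integral\<^sup>N P ?f" .
    have "integral\<^sup>N P ?f \<le> (\<integral>\<^sup>+\<omega>. (\<Prod>j<n. ennreal ((1 - p (d * Suc j)) ^ card {i. X i \<omega> \<in> A j})) \<partial>P)"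
    proof (rule nn_integral_mono_AE)
      show "AE \<omega> in P. ?f \<omega> \<le> (\<Prod>j<n. ennreal ((1 - p (d * Suc j)) ^ card {i. X i \<omega> \<in> A j}))"
        using ppp_AE_nonzero[OF prob ppp lam] AE_space
      proof eventually_elim
        fix \<omega> assume \<omega>: "\<forall>i. X i \<omega> \<noteq> 0" "\<omega> \<in> space P"
        show "?f \<omega> \<le> (\<Prod>j<n. ennreal ((1 - p (d * Suc j)) ^ card {i. X i \<omega> \<in> A j}))"
          unfolding split[OF \<omega>(2,1)]
        proof (rule prod_mono_ennreal)
          fix j
          have "(\<Prod>i\<in>{i. X i \<omega> \<in> A j}. ennreal (1 - p ((norm (X i \<omega>))\<^sup>2))) \<le>
              (\<Prod>i\<in>{i. X i \<omega> \<in> A j}. ennreal (1 - p (d * Suc j)))"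
            by (intro prod_mono_ennreal) (auto intro: ennreal_leI pA simp del: of_nat_Suc)
          also have "\<dots> = ennreal ((1 - p (d * Suc j)) ^ card {i. X i \<omega> \<in> A j})"
            using nn[of "Suc j"] by (simp add: ennreal_power del: of_nat_Suc)
          finally show "(\<Prod>i\<in>{i. X i \<omega> \<in> A j}. ennreal (1 - p ((norm (X i \<omega>))\<^sup>2))) \<le>
              ennreal ((1 - p (d * Suc j)) ^ card {i. X i \<omega> \<in> A j})" .
        qed
      qed
    qed
    also have "\<dots> = ennreal (exp (- (lam * (\<Sum>j<n. measure lborel (A j) * (1 - (1 - p (d * Suc j)))))))"
      by (intro ppp_nn_integral_prod_power_count[OF prob ppp lam] A nn)
    finally show ?thesis
      using lower by (simp add: area d_def[symmetric] sum_distrib_left mult_ac del: of_nat_Suc)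
  qed
  \<comment> \<open>The bounds for a single annulus show the expectation to be finite and positive,
    so it has a real logarithm.\<close>
  obtain w where w: "integral\<^sup>N P ?f = ennreal w" "0 \<le> w"
    using bounds[of 1] by (cases "integral\<^sup>N P ?f" rule: ennreal_cases) (auto simp: top_unique)
  have w_bounds: "exp (- (lam * pi * (\<Sum>j<n. D\<^sup>2 / n * p (D\<^sup>2 / n * real j)))) \<le> w"
      "w \<le> exp (- (lam * pi * (\<Sum>j<n. D\<^sup>2 / n * p (D\<^sup>2 / n * Suc j))))" if "0 < n" for n :: nat
    using bounds[OF that] w by (auto simp del: of_nat_Suc)
  have w_pos: "0 < w" by (rule less_le_trans[OF exp_gt_zero w_bounds(1)[OF zero_less_one]])
  have lp: "0 < lam * pi" using lam by simp
  \<comment> \<open>In logarithmic form the bounds are the left and right step sums of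
    \<open>p\<close>, so squeezing determines the exponent.\<close>
  have "- ln w / (lam * pi) = integral {0..D\<^sup>2} p"
  proof (rule eq_integral_if_between_step_sums[OF anti cont])
    fix n :: nat assume n: "0 < n"
    let ?L = "\<Sum>j<n. D\<^sup>2 / n * p (D\<^sup>2 / n * real j)" and ?U = "\<Sum>j<n. D\<^sup>2 / n * p (D\<^sup>2 / n * Suc j)"
    have "ln (exp (- (lam * pi * ?L))) \<le> ln w"
      using w_bounds(1)[OF n] w_pos by (simp only: ln_le_cancel_iff exp_gt_zero)
    then have "- ln w \<le> lam * pi * ?L" by (subst minus_le_iff) (simp only: ln_exp)
    then show "- ln w / (lam * pi) \<le> ?L"
      by (simp only: pos_divide_le_eq[OF lp] mult.commute[of _ "lam * pi"])
    have "ln w \<le> ln (exp (- (lam * pi * ?U)))"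
      using w_bounds(2)[OF n] w_pos by (simp only: ln_le_cancel_iff exp_gt_zero)
    then have "lam * pi * ?U \<le> - ln w" by (subst le_minus_iff) (simp only: ln_exp)
    then show "?U \<le> - ln w / (lam * pi)"
      by (simp only: pos_le_divide_eq[OF lp] mult.commute[of _ "lam * pi"])
  qed simp
  then have "lam * pi * (- ln w / (lam * pi)) = lam * pi * integral {0..D\<^sup>2} p"
    by (rule arg_cong)
  then have "- (lam * pi * integral {0..D\<^sup>2} p) = ln w"
    using lam by simp
  then show ?thesis using w w_pos by simp
qed

section \<open>The network\<close>

text \<open>Independence makes the joint law a product, as rectangles show, so Fubini permits
  freezing \<open>U\<close> while averaging over \<open>V\<close>. Generated sigma-algebras allow
  \<open>U\<close> and \<open>V\<close> to have different types.\<close>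

lemma (in prob_space) emeasure_indep_vimage_algebra:
  assumes U [measurable]: "U \<in> M \<rightarrow>\<^sub>M A" and V [measurable]: "V \<in> M \<rightarrow>\<^sub>M B"
    and indep: "indep_set (sets (vimage_algebra (space M) U A)) (sets (vimage_algebra (space M) V B))"
    and S [measurable]: "S \<in> sets (A \<Otimes>\<^sub>M B)"
  shows "emeasure M {\<omega> \<in> space M. (U \<omega>, V \<omega>) \<in> S} =
    (\<integral>\<^sup>+\<omega>. emeasure M {\<omega>' \<in> space M. (U \<omega>, V \<omega>') \<in> S} \<partial>M)"
proof -
  interpret U: prob_space "distr M A U" by (rule prob_space_distr) simp
  interpret V: prob_space "distr M B V" by (rule prob_space_distr) simp
  have "distr M A U \<Otimes>\<^sub>M distr M B V = distr M (A \<Otimes>\<^sub>M B) (\<lambda>\<omega>. (U \<omega>, V \<omega>))"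
  proof (rule pair_measure_eqI)
    fix a b assume "a \<in> sets (distr M A U)" "b \<in> sets (distr M B V)"
    then have a [measurable]: "a \<in> sets A" and b [measurable]: "b \<in> sets B" by simp_all
    have "prob ((U -` a \<inter> space M) \<inter> (V -` b \<inter> space M)) =
        prob (U -` a \<inter> space M) * prob (V -` b \<inter> space M)"
      using a b by (intro indep_setD[OF indep] in_vimage_algebra)
    moreover have "(U -` a \<inter> space M) \<inter> (V -` b \<inter> space M) = (\<lambda>\<omega>. (U \<omega>, V \<omega>)) -` (a \<times> b) \<inter> space M"
      by auto
    ultimately show "emeasure (distr M A U) a * emeasure (distr M B V) b =
        emeasure (distr M (A \<Otimes>\<^sub>M B) (\<lambda>\<omega>. (U \<omega>, V \<omega>))) (a \<times> b)"
      by (simp add: emeasure_distr emeasure_eq_measure ennreal_mult'[symmetric])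
  qed (auto intro: U.sigma_finite_measure_axioms V.sigma_finite_measure_axioms)
  then have "emeasure M {\<omega> \<in> space M. (U \<omega>, V \<omega>) \<in> S} = emeasure (distr M A U \<Otimes>\<^sub>M distr M B V) S"
    by (simp add: emeasure_distr vimage_def Int_def conj_commute)
  also have "\<dots> = (\<integral>\<^sup>+u. emeasure (distr M B V) (Pair u -` S) \<partial>distr M A U)"
    by (rule V.emeasure_pair_measure_alt) simp
  also have "\<dots> = (\<integral>\<^sup>+\<omega>. emeasure (distr M B V) (Pair (U \<omega>) -` S) \<partial>M)"
    by (rule nn_integral_distr) (simp_all add: V.measurable_emeasure_Pair)
  also have "\<dots> = (\<integral>\<^sup>+\<omega>. emeasure M {\<omega>' \<in> space M. (U \<omega>, V \<omega>') \<in> S} \<partial>M)"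
    by (intro nn_integral_cong, subst emeasure_distr[OF V sets_Pair1[OF S]])
      (rule arg_cong[where f = "emeasure M"], auto)
  finally show ?thesis .
qed

text \<open>The rows of the doubly indexed family occupy the disjoint blocks
  \<open>{i} \<times> UNIV\<close>, and functions of disjoint blocks are independent.\<close>

lemma (in prob_space) indep_vars_vec:
  fixes H :: "'i \<Rightarrow> 'a \<Rightarrow> 'c::euclidean_space ^ 'm"
  assumes "indep_vars (\<lambda>_. borel) (\<lambda>(i, j) \<omega>. H i \<omega> $ j) UNIV"
  shows "indep_vars (\<lambda>_. borel) H UNIV"
proof -
  have "indep_vars (\<lambda>i. Pi\<^sub>M ({i} \<times> UNIV) (\<lambda>_. borel))
      (\<lambda>i \<omega>. restrict (\<lambda>p. (case p of (i, j) \<Rightarrow> \<lambda>\<omega>. H i \<omega> $ j) \<omega>) ({i} \<times> UNIV)) UNIV"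
    by (rule indep_vars_restrict[OF assms]) (auto simp: disjoint_family_on_def)
  then have "indep_vars (\<lambda>_. borel)
      (\<lambda>i \<omega>. \<chi> j. restrict (\<lambda>p. (case p of (i, j) \<Rightarrow> \<lambda>\<omega>. H i \<omega> $ j) \<omega>) ({i} \<times> UNIV) (i, j)) UNIV"
    by (rule indep_vars_compose2[where Y = "\<lambda>i f. \<chi> j. f (i, j)"])
      (auto intro!: borel_measurable_vec_lambda measurable_component_singleton)
  then show ?thesis by simp
qed

lemma (in prob_space) distr_gaussian_vec:
  fixes h :: "'a \<Rightarrow> complex ^ 'm"
  assumes indep: "indep_vars (\<lambda>_. borel) (\<lambda>j \<omega>. h \<omega> $ j) UNIV"
    and distr: "\<And>j. distr M borel (\<lambda>\<omega>. h \<omega> $ j) = std_complex_gaussian"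
  shows "distr M borel h = gaussian_vec"
proof -
  have [measurable]: "(\<lambda>\<omega>. h \<omega> $ j) \<in> borel_measurable M" for j
    using indep by (auto simp: indep_vars_def2)
  have "distr M (Pi\<^sub>M UNIV (\<lambda>_. borel)) (\<lambda>\<omega>. \<lambda>j\<in>UNIV. h \<omega> $ j) =
      Pi\<^sub>M UNIV (\<lambda>j. distr M borel (\<lambda>\<omega>. h \<omega> $ j))"
    using indep by (subst (asm) indep_vars_iff_distr_eq_PiM) auto
  then have "gaussian_vec = distr (distr M (Pi\<^sub>M UNIV (\<lambda>_. borel)) (\<lambda>\<omega> j. h \<omega> $ j)) borel (\<lambda>f. \<chi> j. f j)"
    by (simp add: gaussian_vec_def distr restrict_UNIV)
  also have "\<dots> = distr M borel (\<lambda>\<omega>. \<chi> j. h \<omega> $ j)"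
    by (subst distr_distr) (auto simp: comp_def intro!: borel_measurable_vec_lambda measurable_PiM_single')
  finally show ?thesis by simp
qed

section \<open>Measurability and law of the maximal SINR\<close>

context obf_network
begin

lemma fading_indep_vec: "indep_vars (\<lambda>_. borel) H UNIV"
  by (rule indep_vars_vec[OF fading_indep])

lemma measurable_H [measurable]: "H i \<in> borel_measurable P"
  using fading_indep_vec by (auto simp: indep_vars_def2)

lemma measurable_X [measurable]: "X i \<in> borel_measurable P"
  using locations by (auto simp: homogeneous_ppp_def)

lemma measurable_B [measurable]: "B k \<in> borel_measurable P"
  by (rule beams_measurable)

lemma distr_H: "distr P borel (H i) = gaussian_vec"
proof (rule distr_gaussian_vec)
  \<comment> \<open>Singleton blocks extract row \<open>i\<close> from the doubly indexed family,
    reindexed by \<open>j\<close>.\<close>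
  have "indep_vars (\<lambda>j. Pi\<^sub>M {(i, j)} (\<lambda>_. borel))
      (\<lambda>j \<omega>. restrict (\<lambda>p. (case p of (i, j) \<Rightarrow> \<lambda>\<omega>. H i \<omega> $ j) \<omega>) {(i, j)}) UNIV"
    by (rule indep_vars_restrict[OF fading_indep]) (auto simp: disjoint_family_on_def)
  then have "indep_vars (\<lambda>_. borel)
      (\<lambda>j \<omega>. restrict (\<lambda>p. (case p of (i, j) \<Rightarrow> \<lambda>\<omega>. H i \<omega> $ j) \<omega>) {(i, j)} (i, j)) UNIV"
    by (rule indep_vars_compose2[where Y = "\<lambda>j f. f (i, j)"])
      (auto intro!: measurable_component_singleton)
  then show "indep_vars (\<lambda>_. borel) (\<lambda>j \<omega>. H i \<omega> $ j) UNIV" by simp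
qed (rule fading_distr)

lemma finite_cell_users: "\<omega> \<in> space P \<Longrightarrow> finite (cell_users D X \<omega>)"
  unfolding cell_users_def
  by (rule ppp_finite[OF prob_space_axioms locations lam_pos bounded_cball])

lemma sinr_nonneg: "0 \<le> g \<Longrightarrow> 0 \<le> sinr rho g h b k"
  using rho_pos unfolding sinr_def
  by (intro divide_nonneg_nonneg add_nonneg_nonneg sum_nonneg) (auto simp: beam_gain_def)

lemma max_sinr_nonneg:
  assumes "\<omega> \<in> space P" and G: "\<And>d. 0 \<le> G d"
  shows "0 \<le> max_sinr G rho D X H B m \<omega>"
proof (cases "cell_users D X \<omega> = {}")
  case False
  then obtain i where "i \<in> cell_users D X \<omega>" by blast
  then have "sinr rho (G (norm (X i \<omega>))) (H i \<omega>) (\<lambda>k. B k \<omega>) m \<le> max_sinr G rho D X H B m \<omega>"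
    using False finite_cell_users[OF assms(1)] by (auto simp: max_sinr_def intro!: Max_ge)
  then show ?thesis using sinr_nonneg[OF G] order_trans by blast
qed (simp add: max_sinr_def)

text \<open>With an empty cell the maximum is \<open>0\<close> by convention, so
  \<open>0 \<le> y\<close> makes it agree with the vacuous quantifier.\<close>

lemma max_sinr_le_iff:
  assumes "\<omega> \<in> space P" "0 \<le> y"
  shows "max_sinr G rho D X H B m \<omega> \<le> y \<longleftrightarrow>
    (\<forall>i\<in>cell_users D X \<omega>. sinr rho (G (norm (X i \<omega>))) (H i \<omega>) (\<lambda>k. B k \<omega>) m \<le> y)"
  using assms finite_cell_users[OF assms(1)] by (auto simp: max_sinr_def)

lemma max_sinr_measurable:
  assumes [measurable]: "G \<in> borel_measurable borel" and G: "\<And>d. 0 \<le> G d"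
  shows "max_sinr G rho D X H B m \<in> borel_measurable P"
proof (rule borel_measurableI_le)
  fix y
  show "{\<omega> \<in> space P. max_sinr G rho D X H B m \<omega> \<le> y} \<in> events"
  proof (cases "0 \<le> y")
    case True
    \<comment> \<open>The random set of users is replaced by a countable conjunction over all
      points, with membership in the cell as a premise.\<close>
    have "{\<omega> \<in> space P. max_sinr G rho D X H B m \<omega> \<le> y} = {\<omega> \<in> space P. \<forall>i.
        norm (X i \<omega>) \<le> D \<longrightarrow> sinr rho (G (norm (X i \<omega>))) (H i \<omega>) (\<lambda>k. B k \<omega>) m \<le> y}"
      using True by (auto simp: max_sinr_le_iff cell_users_def)
    also have "\<dots> \<in> events" unfolding sinr_def by measurable
    finally show ?thesis .
  next
    case False
    then have "{\<omega> \<in> space P. max_sinr G rho D X H B m \<omega> \<le> y} = {}"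
      using max_sinr_nonneg[where G = G, OF _ G] by (auto dest: order_trans)
    then show ?thesis by (simp only: sets.empty_sets)
  qed
qed

lemma emeasure_fading_all:
  assumes "finite I" and S: "\<And>i. i \<in> I \<Longrightarrow> S i \<in> sets borel"
  shows "emeasure P {\<omega> \<in> space P. \<forall>i\<in>I. H i \<omega> \<in> S i} = (\<Prod>i\<in>I. emeasure gaussian_vec (S i))"
proof (cases "I = {}")
  \<comment> \<open>Independence is stated for nonempty index sets, so the case of no users is
    treated apart.\<close>
  case True
  then show ?thesis by (simp add: emeasure_space_1)
next
  case False
  have "prob (\<Inter>i\<in>I. H i -` S i \<inter> space P) = (\<Prod>i\<in>I. prob (H i -` S i \<inter> space P))"
    using False assms by (intro indep_varsD[OF fading_indep_vec]) auto
  moreover have "(\<Inter>i\<in>I. H i -` S i \<inter> space P) = {\<omega> \<in> space P. \<forall>i\<in>I. H i \<omega> \<in> S i}"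
    using False by auto
  moreover have "emeasure gaussian_vec (S i) = ennreal (prob (H i -` S i \<inter> space P))" if "i \<in> I" for i
    unfolding distr_H[of i, symmetric] using S[OF that] by (simp add: emeasure_distr emeasure_eq_measure)
  ultimately show ?thesis
    by (simp add: emeasure_eq_measure prod_ennreal)
qed

lemma sets_sinr_le: "{h. sinr rho g h b m \<le> y} \<in> sets borel"
proof -
  have "{h \<in> space borel. sinr rho g h b m \<le> y} \<in> sets borel"
    unfolding sinr_def by measurable
  then show ?thesis by simp
qed

text \<open>Two rounds of conditioning: first the beams are frozen, then the locations. What remains
  is a product of single-user probabilities, averaged by the Poisson functional. The argument of
  \<open>p\<close> is the squared distance, hence the exponent \<open>\<alpha> / 2\<close>.\<close>

lemma emeasure_max_sinr_le:
  assumes \<alpha>: "0 < \<alpha>" and y: "0 < y"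
  defines "p \<equiv> \<lambda>s. exp (- (y / rho * s powr (\<alpha> / 2))) / (1 + y) ^ (CARD('m) - 1)"
  shows "emeasure P {\<omega> \<in> space P. max_sinr (\<lambda>d. d powr (- \<alpha>)) rho D X H B m \<omega> \<le> y} =
    ennreal (exp (- (lam * pi * integral {0..D\<^sup>2} p)))"
proof -
  let ?XH = "Pi\<^sub>M UNIV (\<lambda>_. borel) \<Otimes>\<^sub>M Pi\<^sub>M UNIV (\<lambda>_. borel) :: ((nat \<Rightarrow> real ^ 2) \<times> (nat \<Rightarrow> complex ^ 'm)) measure"
  let ?MB = "Pi\<^sub>M UNIV (\<lambda>_. borel) :: ('m \<Rightarrow> complex ^ 'm) measure"
  let ?ok = "\<lambda>b x h. \<forall>i. norm (x i) \<le> D \<longrightarrow> sinr rho (norm (x i) powr (- \<alpha>)) (h i) b m \<le> y"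
  let ?S = "{w \<in> space (?MB \<Otimes>\<^sub>M ?XH). ?ok (fst w) (fst (snd w)) (snd (snd w))}"
  have S: "?S \<in> sets (?MB \<Otimes>\<^sub>M ?XH)"
    unfolding sinr_def by measurable
  have S_iff: "(b, x, h) \<in> ?S \<longleftrightarrow> ?ok b x h" for b x h
    by (simp add: space_pair_measure space_PiM)
  have X: "(\<lambda>\<omega> i. X i \<omega>) \<in> P \<rightarrow>\<^sub>M Pi\<^sub>M UNIV (\<lambda>_. borel)" and H: "(\<lambda>\<omega> i. H i \<omega>) \<in> P \<rightarrow>\<^sub>M Pi\<^sub>M UNIV (\<lambda>_. borel)"
    and B: "(\<lambda>\<omega> m. B m \<omega>) \<in> P \<rightarrow>\<^sub>M ?MB"
    by (auto intro!: measurable_PiM_single')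
  have p_le1: "p s \<le> 1" for s
  proof -
    have "exp (- (y / rho * s powr (\<alpha> / 2))) \<le> 1" using y rho_pos by simp
    moreover have "1 \<le> (1 + y) ^ (CARD('m) - 1)" using y by (intro one_le_power) simp
    ultimately have "exp (- (y / rho * s powr (\<alpha> / 2))) \<le> (1 + y) ^ (CARD('m) - 1)"
      by (rule order_trans)
    then show ?thesis unfolding p_def using y by simp
  qed
  have p_anti: "antimono_on {0..} p"
    unfolding p_def using y rho_pos \<alpha>
    by (intro monotone_onI divide_right_mono) (auto intro!: divide_right_mono mult_left_mono powr_mono2)
  have p_cont: "continuous_on {0..} p"
    unfolding p_def using y \<alpha> by (intro continuous_intros continuous_on_powr') auto
  have single: "emeasure gaussian_vec {h. sinr rho (norm v powr (- \<alpha>)) h b m \<le> y} = ennreal (1 - p ((norm v)\<^sup>2))"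
    if "orthonormal_beams b" "v \<noteq> 0" for b and v :: "real ^ 2"
    \<comment> \<open>At \<open>v = 0\<close> this fails for a single antenna: \<open>0 powr - \<alpha> = 0\<close> makes the SINR \<open>x / 0 = 0\<close>.\<close>
  proof -
    have "y * inverse (rho * norm v powr (- \<alpha>)) = y / rho * norm v powr \<alpha>"
      by (simp add: powr_minus divide_inverse)
    also have "norm v powr \<alpha> = ((norm v)\<^sup>2) powr (\<alpha> / 2)"
      using that by (simp add: powr_powr flip: powr_numeral)
    finally show ?thesis
      using that y rho_pos by (subst emeasure_sinr_le) (auto simp: p_def)
  qed
  \<comment> \<open>The value is the same for every orthonormal family, so the later average over
    random beams is that of a constant.\<close>
  have given_b: "emeasure P {\<omega> \<in> space P. ?ok b (\<lambda>i. X i \<omega>) (\<lambda>i. H i \<omega>)} =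
      ennreal (exp (- (lam * pi * integral {0..D\<^sup>2} p)))" if b: "orthonormal_beams b" for b
  proof -
    have "emeasure P {\<omega> \<in> space P. ?ok b (\<lambda>i. X i \<omega>) (\<lambda>i. H i \<omega>)} =
        emeasure P {\<omega> \<in> space P. ((\<lambda>i. X i \<omega>), (\<lambda>i. H i \<omega>)) \<in> Pair b -` ?S}"
      unfolding vimage_eq S_iff ..
    also have "\<dots> = (\<integral>\<^sup>+\<omega>. emeasure P {\<omega>' \<in> space P. ((\<lambda>i. X i \<omega>), (\<lambda>i. H i \<omega>')) \<in> Pair b -` ?S} \<partial>P)"
      by (rule emeasure_indep_vimage_algebra[OF X H locations_indep_fading sets_Pair1[OF S]])
    also have "\<dots> = (\<integral>\<^sup>+\<omega>. (\<Prod>i\<in>cell_users D X \<omega>. ennreal (1 - p ((norm (X i \<omega>))\<^sup>2))) \<partial>P)"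
    proof (rule nn_integral_cong_AE)
      \<comment> \<open>Equality holds only almost surely, since \<open>single\<close> needs users
        off the centre.\<close>
      show "AE \<omega> in P. emeasure P {\<omega>' \<in> space P. ((\<lambda>i. X i \<omega>), (\<lambda>i. H i \<omega>')) \<in> Pair b -` ?S} =
          (\<Prod>i\<in>cell_users D X \<omega>. ennreal (1 - p ((norm (X i \<omega>))\<^sup>2)))"
        using ppp_AE_nonzero[OF prob_space_axioms locations lam_pos] AE_space
      proof eventually_elim
        fix \<omega> assume \<omega>: "\<forall>i. X i \<omega> \<noteq> 0" "\<omega> \<in> space P"
        have "{\<omega>' \<in> space P. ((\<lambda>i. X i \<omega>), (\<lambda>i. H i \<omega>')) \<in> Pair b -` ?S} =
            {\<omega>' \<in> space P. \<forall>i\<in>cell_users D X \<omega>. H i \<omega>' \<in> {h. sinr rho (norm (X i \<omega>) powr (- \<alpha>)) h b m \<le> y}}"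
          unfolding vimage_eq S_iff by (auto simp: cell_users_def)
        moreover have "emeasure P \<dots> =
            (\<Prod>i\<in>cell_users D X \<omega>. emeasure gaussian_vec {h. sinr rho (norm (X i \<omega>) powr (- \<alpha>)) h b m \<le> y})"
          using \<omega> by (intro emeasure_fading_all finite_cell_users sets_sinr_le)
        moreover have "\<dots> = (\<Prod>i\<in>cell_users D X \<omega>. ennreal (1 - p ((norm (X i \<omega>))\<^sup>2)))"
          using \<omega> b by (intro prod.cong refl single) auto
        ultimately show "emeasure P {\<omega>' \<in> space P. ((\<lambda>i. X i \<omega>), (\<lambda>i. H i \<omega>')) \<in> Pair b -` ?S} =
          (\<Prod>i\<in>cell_users D X \<omega>. ennreal (1 - p ((norm (X i \<omega>))\<^sup>2)))"
          by (simp only:)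
      qed
    qed
    also have "\<dots> = ennreal (exp (- (lam * pi * integral {0..D\<^sup>2} p)))"
      by (rule ppp_nn_integral_radial_prod[OF prob_space_axioms locations lam_pos less_imp_le[OF D_pos] p_anti p_cont p_le1])
    finally show ?thesis .
  qed
  have "emeasure P {\<omega> \<in> space P. max_sinr (\<lambda>d. d powr (- \<alpha>)) rho D X H B m \<omega> \<le> y} =
      emeasure P {\<omega> \<in> space P. ((\<lambda>k. B k \<omega>), (\<lambda>i. X i \<omega>), (\<lambda>i. H i \<omega>)) \<in> ?S}"
    unfolding S_iff using y by (intro arg_cong[where f = "emeasure P"]) (auto simp: max_sinr_le_iff cell_users_def)
  also have "\<dots> = (\<integral>\<^sup>+\<omega>. emeasure P {\<omega>' \<in> space P. ((\<lambda>k. B k \<omega>), (\<lambda>i. X i \<omega>'), (\<lambda>i. H i \<omega>')) \<in> ?S} \<partial>P)"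
    by (rule emeasure_indep_vimage_algebra[OF B measurable_Pair[OF X H] beams_indep S])
  also have "\<dots> = (\<integral>\<^sup>+\<omega>. ennreal (exp (- (lam * pi * integral {0..D\<^sup>2} p))) \<partial>P)"
    unfolding S_iff by (intro nn_integral_cong given_b beams_orthonormal)
  also have "\<dots> = ennreal (exp (- (lam * pi * integral {0..D\<^sup>2} p)))"
    by (simp add: emeasure_space_1)
  finally show ?thesis .
qed

end

theorem lemma1:
  fixes P :: "'a measure"
    and lam rho D \<alpha> x :: real
    and X :: "nat \<Rightarrow> 'a \<Rightarrow> real ^ 2"
    and H :: "nat \<Rightarrow> 'a \<Rightarrow> complex ^ 'm"
    and B :: "'m \<Rightarrow> 'a \<Rightarrow> complex ^ 'm"
    and m :: 'm
    and G :: "real \<Rightarrow> real"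
  assumes "obf_network P lam rho D X H B"
    and "\<alpha> > 2"
    and "G = (\<lambda>d. d powr (- \<alpha>))"
    and "x > 0"
  shows "beam_outage P G rho D X H B m x = max_sinr_cdf P G rho D X H B m (exp x - 1) \<and>
    (\<forall>y>0. max_sinr_cdf P G rho D X H B m y =
       exp ((- 2 * lam * pi) / (\<alpha> * (y + 1) ^ (CARD('m) - 1)) * (rho / y) powr (2 / \<alpha>) *
            lower_incomplete_gamma (2 / \<alpha>) (y * D powr \<alpha> / rho)))"
proof -
  interpret obf_network P lam rho D X H B by fact
  have G [measurable]: "G \<in> borel_measurable borel" and G_nonneg: "0 \<le> G d" for d
    using assms(3) by auto
  have [measurable]: "max_sinr G rho D X H B m \<in> borel_measurable P"
    by (rule max_sinr_measurable[OF G G_nonneg])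
  have cdf: "max_sinr_cdf P G rho D X H B m y = prob {\<omega> \<in> space P. max_sinr G rho D X H B m \<omega> \<le> y}" for y
    by (simp add: max_sinr_cdf_def cdf_def measure_distr vimage_def Int_def conj_commute)
  \<comment> \<open>Nonnegativity of the maximum keeps the argument of \<open>ln\<close> positive,
    where \<open>exp\<close> inverts it; hence both events coincide.\<close>
  have "beam_rate G rho D X H B m \<omega> \<le> x \<longleftrightarrow> max_sinr G rho D X H B m \<omega> \<le> exp x - 1" if "\<omega> \<in> space P" for \<omega>
  proof -
    have "0 < 1 + max_sinr G rho D X H B m \<omega>"
      using max_sinr_nonneg[where G = G, OF that G_nonneg] by (simp add: add_pos_nonneg)
    then have "ln (1 + max_sinr G rho D X H B m \<omega>) \<le> x \<longleftrightarrow> 1 + max_sinr G rho D X H B m \<omega> \<le> exp x"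
      by (metis exp_le_cancel_iff exp_ln)
    then show ?thesis by (auto simp: beam_rate_def)
  qed
  then have outage: "beam_outage P G rho D X H B m x = max_sinr_cdf P G rho D X H B m (exp x - 1)"
    unfolding cdf beam_outage_def by (intro arg_cong[where f = prob]) auto
  have "max_sinr_cdf P G rho D X H B m y =
       exp ((- 2 * lam * pi) / (\<alpha> * (y + 1) ^ (CARD('m) - 1)) * (rho / y) powr (2 / \<alpha>) *
            lower_incomplete_gamma (2 / \<alpha>) (y * D powr \<alpha> / rho))" if y: "0 < y" for y
  proof -
    \<comment> \<open>The interference factor \<open>?c\<close> does not depend on the distance and
      leaves the integral; the rest is the incomplete gamma integral with
      \<open>a = y / rho\<close>.\<close>
    let ?c = "(1 + y) ^ (CARD('m) - 1)" and ?f = "\<lambda>s. exp (- (y / rho * s powr (\<alpha> / 2)))"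
    have "integral {0..D\<^sup>2} (\<lambda>s. ?f s / ?c) = integral {0..D\<^sup>2} ?f / ?c"
      by (rule integral_divide)
    also have "integral {0..D\<^sup>2} ?f = 2 / \<alpha> * (1 / (y / rho)) powr (2 / \<alpha>) *
        lower_incomplete_gamma (2 / \<alpha>) (y / rho * D powr \<alpha>)"
      using assms(2) y rho_pos D_pos by (intro integral_exp_powr) auto
    finally have "- (lam * pi * integral {0..D\<^sup>2} (\<lambda>s. ?f s / ?c)) =
        (- 2 * lam * pi) / (\<alpha> * (y + 1) ^ (CARD('m) - 1)) * (rho / y) powr (2 / \<alpha>) *
            lower_incomplete_gamma (2 / \<alpha>) (y * D powr \<alpha> / rho)"
      by (simp add: add.commute)
    then show ?thesis
      unfolding cdf unfolding assms(3) using emeasure_max_sinr_le[of \<alpha> y m] assms(2) y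
      by (simp add: emeasure_eq_measure)
  qed
  with outage show ?thesis by blast
qed

end
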